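(* Assume that the union of any family of fewer than $\mathfrak{c}$ many meager subsets of $\mathbb{R}$ is meager in $\mathbb{R}$. Then there exists a function $f\colon\mathbb{R}\to\mathbb{R}$ which is additive, has the Cantor intermediate value property, is a connectivity function, and is not almost continuous.
   Context: $\mathfrak{c}$ denotes the cardinality of $\mathbb{R}$. A function is identified with its graph. A Cantor set is any nonempty perfect nowhere dense subset of $\mathbb{R}$. A set is "between" two reals $p,q$ if it is contained in the open interval with endpoints $p$ and $q$ (empty if $p=q$). A function $f\colon\mathbb{R}\to\mathbb{R}$: - is additive if $f(x+y)=f(x)+f(y)$ for all $x,y\in\mathbb{R}$; - is almost continuous (in the sense of Stallings) if each open subset of $\mathbb{R}\times\mathbb{R}$ containing the graph of $f$ also contains the graph of a continuous function from $\mathbb{R}$ to $\mathbb{R}$; - has the Cantor intermediate value property if for every $x,y\in\mathbb{R}$ and every Cantor set $K$ between $f(x)$ and $f(y)$ there is a Cantor set $C$ between $x$ and $y$ such that $f[C]\subset K$; - is a connectivity function if for every connected $Z\subset\mathbb{R}$ the graph of $f\restriction Z$ is connected in $Z\times\mathbb{R}$. *)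

theory Defs
  imports "HOL-Analysis.Analysis" "HOL-Library.Equipollence"
begin

definition nowhere_dense :: "'a::topological_space set \<Rightarrow> bool" where
  "nowhere_dense A \<longleftrightarrow> interior (closure A) = {}"

definition meager :: "'a::topological_space set \<Rightarrow> bool" where
  "meager A \<longleftrightarrow> (\<exists>\<N>. countable \<N> \<and> (\<forall>N\<in>\<N>. nowhere_dense N) \<and> A = \<Union>\<N>)"

definition perfect_set :: "'a::topological_space set \<Rightarrow> bool" where
  "perfect_set S \<longleftrightarrow> closed S \<and> (\<forall>x\<in>S. x islimpt S)"

text \<open>Compactness is not required; the Cantor sets used below lie in bounded intervals
  and are therefore compact anyway.\<close>

definition Cantor_set :: "real set \<Rightarrow> bool" where
  "Cantor_set K \<longleftrightarrow> K \<noteq> {} \<and> perfect_set K \<and> nowhere_dense K"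

definition fun_graph :: "('a \<Rightarrow> 'b) \<Rightarrow> 'a set \<Rightarrow> ('a \<times> 'b) set" where
  "fun_graph f S = {(x, f x) | x. x \<in> S}"

definition almost_continuous :: "(real \<Rightarrow> real) \<Rightarrow> bool" where
  "almost_continuous f \<longleftrightarrow>
     (\<forall>U. open U \<and> fun_graph f UNIV \<subseteq> U \<longrightarrow>
        (\<exists>g. continuous_on UNIV g \<and> fun_graph g UNIV \<subseteq> U))"

text \<open>\<^term>\<open>open_segment p q\<close> is the open interval with endpoints \<^term>\<open>p\<close> and \<^term>\<open>q\<close> in
  either order, and is empty for \<^prop>\<open>p = q\<close>.\<close>

definition Cantor_ivp :: "(real \<Rightarrow> real) \<Rightarrow> bool" where
  "Cantor_ivp f \<longleftrightarrow>
     (\<forall>x y K. Cantor_set K \<and> K \<subseteq> open_segment (f x) (f y) \<longrightarrow>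
        (\<exists>C. Cantor_set C \<and> C \<subseteq> open_segment x y \<and> f ` C \<subseteq> K))"

definition connectivity_function :: "(real \<Rightarrow> real) \<Rightarrow> bool" where
  "connectivity_function f \<longleftrightarrow> (\<forall>Z. connected Z \<longrightarrow> connected (fun_graph f Z))"

end

theory Submission
  imports Defs
begin

text \<open>A barrier \<open>K\<close> in the plane lies over the open unit interval: a drift from \<open>+\<infinity>\<close> down to \<open>-\<infinity>\<close>
  with upward jumps at a dense set \<open>D\<close>, without the vertical segments at the jumps. A continuous
  function would have to cross \<open>K\<close> in the direction in which no jump helps, so it meets \<open>K\<close>; an
  additive \<open>f\<close> that avoids \<open>K\<close> is therefore not almost continuous. Such an \<open>f\<close> is built by transfinite
  recursion as an increasing union of rational subspaces of the plane with fewer than continuum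
  many generators. Members of a perfect set of rationally independent numbers receive their
  values in prescribed Cantor sets, which yields the Cantor intermediate value property, and the
  points of \<open>D\<close> receive values inside the jumps of \<open>K\<close>. For connectivity \<open>f\<close> has to hit the
  complement of \<open>U \<union> V\<close> for disjoint open \<open>U\<close>, \<open>V\<close> with overlapping projections. If no new point
  does this, the additivity assumption on category shows that over some interval the boundary
  between \<open>U\<close> and \<open>V\<close> follows an affine copy of \<open>K\<close>; the corresponding jumps then lie outside
  \<open>U \<union> V\<close>, and \<open>f\<close> passes through one of them.\<close>

section \<open>Cardinalities below the continuum\<close>

text \<open>Connectivity and avoidance of \<open>K\<close> pull against each other. An additive
  \<open>f\<close> that avoids \<open>K\<close> also avoids each image of \<open>K\<close> under (a,
  k) -> ((a - z) / c, (k - w) / c), with c a nonzero rational and (z, w) on the graph, and each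
  image is almost a curve that \<open>f\<close> has to cross. The way out is prepared in advance:
  \<open>f d\<close> is promised inside the jump at each \<open>d\<close> in \<open>D\<close>, and
  additivity carries this value into the corresponding jump of every image. Promises are attached to
  a rationally independent set \<open>T\<close>. At each stage the points entangled with them form a
  union of fewer than continuum many translates of the span of \<open>T\<close>, which is negligible
  once that span is meager. This dictates the explicit family of numbers: it is parametrised by the
  Cantor space, hence compact and large, it is independent, and omitting one number leaves compact
  parts whose span is proper and therefore a countable union of nowhere dense compact sets.\<close>

lemma lepoll_iff_card_of: "A \<lesssim> B \<longleftrightarrow> (card_of A, card_of B) \<in> ordLeq"
  by (simp add: card_of_ordLeq lepoll_def)

lemma lesspoll_iff_card_of: "A \<prec> B \<longleftrightarrow> (card_of A, card_of B) \<in> ordLess"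
proof -
  have "A \<prec> B \<longleftrightarrow> \<not> B \<lesssim> A"
    unfolding lesspoll_def
    by (metis card_of_Well_order eqpoll_imp_lepoll eqpoll_sym lepoll_antisym lepoll_iff_card_of
        not_ordLeq_iff_ordLess ordLess_imp_ordLeq)
  also have "\<dots> \<longleftrightarrow> (card_of A, card_of B) \<in> ordLess"
    unfolding lepoll_iff_card_of by (intro not_ordLeq_iff_ordLess card_of_Well_order)
  finally show ?thesis .
qed

lemma not_lepoll_iff_lesspoll: "\<not> B \<lesssim> A \<longleftrightarrow> A \<prec> B"
  unfolding lepoll_iff_card_of lesspoll_iff_card_of
  by (intro not_ordLeq_iff_ordLess card_of_Well_order)

lemma countable_lesspoll_real:
  assumes "countable A"
  shows "A \<prec> (UNIV :: real set)"
  using assms countable_lepoll not_lepoll_iff_lesspoll uncountable_UNIV_real by blast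

lemma UN_lepoll_infinite:
  assumes "infinite B" "I \<lesssim> B" "\<And>i. i \<in> I \<Longrightarrow> A i \<lesssim> B"
  shows "(\<Union>i\<in>I. A i) \<lesssim> B"
  using assms by (simp add: lepoll_iff_card_of card_of_UNION_ordLeq_infinite)

lemma Times_lepoll_infinite:
  assumes "infinite B" "I \<lesssim> B" "A \<lesssim> B"
  shows "I \<times> A \<lesssim> B"
  using assms by (simp add: lepoll_iff_card_of card_of_Sigma_ordLeq_infinite)

lemma countable_lepoll_infinite: "countable A \<Longrightarrow> infinite B \<Longrightarrow> A \<lesssim> B"
  by (metis countableE infinite_le_lepoll lepoll_def lepoll_trans subset_UNIV)

lemma Un_lesspoll_real:
  assumes "A \<prec> (UNIV :: real set)" "B \<prec> (UNIV :: real set)"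
  shows "A \<union> B \<prec> (UNIV :: real set)"
proof (cases "infinite A \<or> infinite B")
  case True
  then consider "infinite A" "B \<lesssim> A" | "infinite B" "A \<lesssim> B"
    by (metis lesspoll_imp_lepoll not_lepoll_iff_lesspoll finite_lepoll_infinite)
  then show ?thesis
  proof cases
    case 1
    then have "(\<Union>i\<in>{A,B}. i) \<lesssim> A"
      by (intro UN_lepoll_infinite) (auto simp: finite_lepoll_infinite)
    then show ?thesis using assms lesspoll_trans1 by force
  next
    case 2
    then have "(\<Union>i\<in>{A,B}. i) \<lesssim> B"
      by (intro UN_lepoll_infinite) (auto simp: finite_lepoll_infinite)
    then show ?thesis using assms lesspoll_trans1 by force
  qed
qed (auto intro: countable_lesspoll_real countable_finite)

text \<open>The continuum may be singular, so a union of fewer than continuum many smaller sets can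
  be too large. With countable pieces it is bounded by the cardinality of an infinite index
  set.\<close>

lemma UN_countable_lesspoll_real:
  assumes "I \<prec> (UNIV :: real set)" "\<And>i. i \<in> I \<Longrightarrow> countable (A i)"
  shows "(\<Union>i\<in>I. A i) \<prec> (UNIV :: real set)"
proof (cases "countable I")
  case True
  then show ?thesis
    using assms by (auto intro: countable_lesspoll_real)
next
  case False
  then have "infinite I" using countable_finite by blast
  then have "(\<Union>i\<in>I. A i) \<lesssim> I"
    using assms by (intro UN_lepoll_infinite) (auto simp: countable_lepoll_infinite)
  then show ?thesis using assms lesspoll_trans1 by blast
qed

lemma countable_Times_lesspoll_real:
  assumes "A \<prec> (UNIV :: real set)" "countable I"
  shows "I \<times> A \<prec> (UNIV :: real set)"
proof (cases "finite A")
  case True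
  then show ?thesis
    using assms by (auto intro: countable_lesspoll_real countable_finite)
next
  case False
  then have "I \<times> A \<lesssim> A"
    using assms by (intro Times_lepoll_infinite) (auto intro: countable_lepoll_infinite)
  then show ?thesis using assms lesspoll_trans1 by blast
qed

lemma image_lesspoll: "A \<prec> B \<Longrightarrow> f ` A \<prec> B"
  using image_lepoll lesspoll_trans1 by blast

lemma perfect_set_lepoll:
  fixes S :: "real set"
  assumes "perfect_set S" "S \<noteq> {}"
  shows "(UNIV :: real set) \<lesssim> S"
proof (rule lepoll_perfect_set)
  show "completely_metrizable_space (euclidean :: real topology) \<or> 
     locally_compact_space (euclidean :: real topology) \<and> Hausdorff_space (euclidean :: real topology)"
    using completely_metrizable_space_euclidean by blast
  have "euclidean derived_set_of S = {x. x islimpt S}"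
    unfolding derived_set_of_def islimpt_def by auto
  also have "\<dots> = S"
    using assms closed_limpt unfolding perfect_set_def by auto
  finally show "euclidean derived_set_of S = S" .
qed (use assms in auto)

section \<open>Linear algebra over the rationals\<close>

definition rat_scale :: "rat \<Rightarrow> 'a::real_vector \<Rightarrow> 'a" where
  "rat_scale q v = of_rat q *\<^sub>R v"

text \<open>One scaling serves the line and the plane, so domains and graphs of partial additive
  functions are subspaces over the same scalars.\<close>

global_interpretation rat_vec: vector_space rat_scale
  defines rat_span = rat_vec.span and rat_dependent = rat_vec.dependent
  by unfold_locales (auto simp: rat_scale_def algebra_simps of_rat_add of_rat_mult)

lemma rat_scale_real [simp]: "rat_scale q (x::real) = of_rat q * x"
  by (simp add: rat_scale_def)

lemma rat_scale_Pair [simp]: "rat_scale q (x, y) = (rat_scale q x, rat_scale q y)"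
  by (simp add: rat_scale_def)

lemma span_lesspoll_real:
  assumes "S \<prec> (UNIV :: real set)"
  shows "rat_span S \<prec> (UNIV :: real set)"
proof -
  \<comment> \<open>The added \<open>0\<close> keeps \<open>B\<close> infinite when \<open>S\<close>
    is empty, as the cardinal arithmetic requires.\<close>
  define B where "B = (UNIV :: rat set) \<times> insert 0 S"
  have inf: "infinite B"
    unfolding B_def by (simp add: finite_cartesian_product_iff infinite_UNIV_char_0)
  have "insert 0 S \<prec> (UNIV :: real set)"
    using Un_lesspoll_real[OF assms, of "{0}"] by (simp add: countable_lesspoll_real)
  then have B: "B \<prec> (UNIV :: real set)"
    unfolding B_def by (intro countable_Times_lesspoll_real) auto
  \<comment> \<open>Level \<open>n\<close> consists of the combinations with \<open>n\<close> terms;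
    no level is larger than \<open>B\<close>, and countably many levels exhaust the span.\<close>
  define A where "A = rec_nat {0} (\<lambda>_ X. (\<lambda>((c,x),y). rat_scale c x + y) ` (B \<times> X))"
  have A_Suc: "A (Suc n) = (\<lambda>((c,x),y). rat_scale c x + y) ` (B \<times> A n)" and A_0: "A 0 = {0}" for n
    by (simp_all add: A_def)
  have "A n \<lesssim> B" for n
  proof (induction n)
    case 0
    then show ?case by (simp add: A_0 inf finite_lepoll_infinite)
  next
    case (Suc n)
    have "A (Suc n) \<lesssim> B \<times> A n"
      by (simp add: A_Suc image_lepoll)
    also have "B \<times> A n \<lesssim> B"
      using Suc inf by (intro Times_lepoll_infinite) auto
    finally show ?case .
  qed
  then have "(\<Union>n. A n) \<lesssim> B"
    using inf by (intro UN_lepoll_infinite) (auto simp: infinite_le_lepoll[symmetric])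
  moreover have "rat_span S \<subseteq> (\<Union>n. A n)"
  proof
    fix x assume "x \<in> rat_span S"
    then show "x \<in> (\<Union>n. A n)"
    proof (induction rule: rat_vec.span_induct_alt)
      case base
      then show ?case using A_0 by blast
    next
      case (step c x y)
      then obtain n where "y \<in> A n" by auto
      then have "rat_scale c x + y \<in> A (Suc n)"
        using step by (force simp: A_Suc B_def)
      then show ?case by blast
    qed
  qed
  ultimately show ?thesis
    using B by (meson lesspoll_trans1 lepoll_trans subset_imp_lepoll)
qed

text \<open>A combination uses finitely many generators, and in a chain these lie in a single
  member.\<close>

lemma span_chain_Union:
  assumes "\<C> \<noteq> {}" "\<And>A B. A \<in> \<C> \<Longrightarrow> B \<in> \<C> \<Longrightarrow> A \<subseteq> B \<or> B \<subseteq> A"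
  shows "rat_span (\<Union>\<C>) = (\<Union>A\<in>\<C>. rat_span A)"
proof (intro equalityI subsetI)
  fix x assume "x \<in> rat_span (\<Union>\<C>)"
  then show "x \<in> (\<Union>A\<in>\<C>. rat_span A)"
  proof (induction rule: rat_vec.span_induct_alt)
    case base
    then show ?case using assms(1) rat_vec.span_zero by blast
  next
    case (step c x y)
    then obtain A B where AB: "x \<in> A" "A \<in> \<C>" "B \<in> \<C>" "y \<in> rat_span B" by auto
    then obtain C where "C \<in> \<C>" "A \<subseteq> C" "B \<subseteq> C" using assms(2) by blast
    then show ?case using AB
      by (meson UN_I rat_vec.span_add rat_vec.span_base rat_vec.span_mono rat_vec.span_scale subset_iff)
  qed
qed (meson UN_E Union_upper rat_vec.span_mono subsetD)

text \<open>Transfinite recursion along a well-order of the tasks in which every initial segment has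
  fewer than continuum many elements.\<close>

lemma transfinite_construction:
  fixes Q :: "'b set \<Rightarrow> bool" and I :: "'i set"
  assumes I: "I \<lesssim> (UNIV :: real set)"
    and empty: "Q {}"
    and chain: "\<And>\<C>. \<C> \<noteq> {} \<Longrightarrow> (\<And>A. A \<in> \<C> \<Longrightarrow> Q A) \<Longrightarrow>
       (\<And>A B. A \<in> \<C> \<Longrightarrow> B \<in> \<C> \<Longrightarrow> A \<subseteq> B \<or> B \<subseteq> A) \<Longrightarrow> Q (\<Union>\<C>)"
    and step: "\<And>S i. Q S \<Longrightarrow> S \<prec> (UNIV :: real set) \<Longrightarrow> i \<in> I \<Longrightarrow>
       \<exists>F. finite F \<and> Q (S \<union> F) \<and> task i (S \<union> F)"
    and mono: "\<And>S S' i. task i S \<Longrightarrow> S \<subseteq> S' \<Longrightarrow> task i S'"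
  shows "\<exists>S. Q S \<and> (\<forall>i\<in>I. task i S)"
proof -
  obtain r where "r = card_of I" by blast
  note r_def = this
  have wo: "Well_order r" and F: "Field r = I" and co: "Card_order r"
    using card_of_Well_order[of I] card_of_Card_order[of I] unfolding r_def by (simp_all add: Field_card_of)
  have wf: "wf (r - Id)" using wo by (simp add: well_order_on_def)
  \<comment> \<open>Only the finite set added at a stage is recorded; what precedes it is recovered
    as a union over the predecessors, which keeps its size visible.\<close>
  define upd where "upd g i = (SOME F. finite F \<and> Q (\<Union>(g ` underS r i) \<union> F) \<and> task i (\<Union>(g ` underS r i) \<union> F))"
    for g :: "'i \<Rightarrow> 'b set" and i
  define g where "g = wfrec (r - Id) upd"
  have g: "g i = upd g i" for i
  proof -
    have "adm_wf (r - Id) upd"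
      unfolding adm_wf_def
    proof (intro allI impI)
      fix f g :: "'i \<Rightarrow> 'b set" and x
      assume "\<forall>z. (z, x) \<in> r - Id \<longrightarrow> f z = g z"
      then have "f ` underS r x = g ` underS r x"
        by (intro image_cong) (auto simp: underS_def)
      then show "upd f x = upd g x" by (simp add: upd_def)
    qed
    then show ?thesis
      unfolding g_def using wfrec_fixpoint[OF wf] by metis
  qed
  define S where "S i = \<Union>(g ` underS r i)" for i
  have trans: "trans r" and asym: "antisym r" and tot: "total_on I r"
    using wo by (simp_all add: F well_order_on_def linear_order_on_def partial_order_on_def
      preorder_on_def)
  have lin: "i = j \<or> i \<in> underS r j \<or> j \<in> underS r i" if "i \<in> I" "j \<in> I" for i j
    using tot that unfolding total_on_def underS_def by blast
  have under_trans: "k \<in> underS r j \<Longrightarrow> j \<in> underS r i \<Longrightarrow> k \<in> underS r i" for i j k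
    using trans asym unfolding underS_def trans_def antisym_def by blast
  have S_mono: "S j \<union> g j \<subseteq> S i" if "j \<in> underS r i" for i j
    using that under_trans unfolding S_def by blast
  have underI: "underS r i \<subseteq> I" for i
    using F unfolding underS_def Field_def by blast
  have comparable: "S i \<union> g i \<subseteq> S j \<union> g j \<or> S j \<union> g j \<subseteq> S i \<union> g i" if "i \<in> I" "j \<in> I" for i j
    using lin[OF that] S_mono by blast
  have main: "i \<in> I \<Longrightarrow> finite (g i) \<and> Q (S i \<union> g i) \<and> task i (S i \<union> g i)" for i
  proof (induction i rule: wf_induct_rule[OF wf])
    case (1 i)
    have IH: "finite (g j) \<and> Q (S j \<union> g j)" if "j \<in> underS r i" for j
      using 1 that underI unfolding underS_def by blast
    have "underS r i \<prec> I"
      using card_of_underS[OF co] 1(2) F by (simp add: lesspoll_iff_card_of r_def)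
    then have "underS r i \<prec> (UNIV :: real set)"
      using I lesspoll_trans2 by blast
    \<comment> \<open>Finite additions along fewer than continuum many stages stay below the
      continuum, whatever its cofinality.\<close>
    then have small: "S i \<prec> (UNIV :: real set)"
      unfolding S_def using IH by (intro UN_countable_lesspoll_real countable_finite) auto
    have "Q (S i)"
    proof (cases "underS r i = {}")
      case True
      then show ?thesis using empty by (simp add: S_def)
    next
      case False
      have "S i = \<Union>((\<lambda>j. S j \<union> g j) ` underS r i)"
        using S_mono by (force simp: S_def)
      moreover have "Q (\<Union>((\<lambda>j. S j \<union> g j) ` underS r i))"
      proof (rule chain)
        fix A B assume "A \<in> (\<lambda>j. S j \<union> g j) ` underS r i" "B \<in> (\<lambda>j. S j \<union> g j) ` underS r i"
        then show "A \<subseteq> B \<or> B \<subseteq> A" using comparable underI[of i] by blast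
      qed (use False IH in \<open>blast+\<close>)
      ultimately show ?thesis by simp
    qed
    from step[OF this small 1(2)] show ?case
      unfolding g[of i] upd_def S_def by (rule someI_ex)
  qed
  show ?thesis
  proof (cases "I = {}")
    case True
    then show ?thesis using empty by blast
  next
    case False
    have "Q (\<Union>((\<lambda>j. S j \<union> g j) ` I))"
    proof (rule chain)
      fix A B assume "A \<in> (\<lambda>j. S j \<union> g j) ` I" "B \<in> (\<lambda>j. S j \<union> g j) ` I"
      then show "A \<subseteq> B \<or> B \<subseteq> A" using comparable by blast
    qed (use False main in \<open>blast+\<close>)
    moreover have "task i (\<Union>((\<lambda>j. S j \<union> g j) ` I))" if "i \<in> I" for i
      by (rule mono[of i "S i \<union> g i"]) (use main[OF that] that in blast)+
    ultimately show ?thesis by blast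
  qed
qed

section \<open>Meager sets and rational spans\<close>

lemma nowhere_dense_subset: "nowhere_dense B \<Longrightarrow> A \<subseteq> B \<Longrightarrow> nowhere_dense A"
  unfolding nowhere_dense_def by (metis closure_mono interior_mono subset_empty)

lemma meager_subset:
  assumes "meager B" "A \<subseteq> B"
  shows "meager A"
proof -
  obtain \<N> where N: "countable \<N>" "\<forall>N\<in>\<N>. nowhere_dense N" "B = \<Union>\<N>"
    using assms(1) unfolding meager_def by blast
  have "\<forall>N\<in>(\<inter>) A ` \<N>. nowhere_dense N"
    using N nowhere_dense_subset by (metis imageE inf_le2)
  moreover have "A = \<Union>((\<inter>) A ` \<N>)" using assms N by blast
  ultimately show ?thesis using N(1) unfolding meager_def by blast
qed

lemma nowhere_dense_imp_meager: "nowhere_dense A \<Longrightarrow> meager A"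
  unfolding meager_def by (intro exI[of _ "{A}"]) auto

lemma meager_UN:
  assumes "countable I" "\<And>i. i \<in> I \<Longrightarrow> meager (A i)"
  shows "meager (\<Union>i\<in>I. A i)"
proof -
  have "\<forall>i\<in>I. \<exists>\<N>. countable \<N> \<and> (\<forall>N\<in>\<N>. nowhere_dense N) \<and> A i = \<Union>\<N>"
    using assms(2) unfolding meager_def by blast
  then obtain \<N> where N: "\<And>i. i \<in> I \<Longrightarrow> countable (\<N> i) \<and> (\<forall>N\<in>\<N> i. nowhere_dense N) \<and> A i = \<Union>(\<N> i)"
    by metis
  show ?thesis
    unfolding meager_def
    by (intro exI[of _ "\<Union>i\<in>I. \<N> i"]) (use N assms(1) in auto)
qed

lemma meager_Un: "meager A \<Longrightarrow> meager B \<Longrightarrow> meager (A \<union> B)"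
  using meager_UN[of "{A, B}" id] by auto

lemma open_not_meager:
  fixes U :: "real set"
  assumes "open U" "U \<noteq> {}"
  shows "\<not> meager U"
proof
  assume "meager U"
  then obtain \<N> where N: "countable \<N>" "\<And>N. N \<in> \<N> \<Longrightarrow> nowhere_dense N" "U = \<Union>\<N>"
    unfolding meager_def by blast
  define \<G> where "\<G> = (\<lambda>N. - closure N) ` \<N>"
  have "UNIV \<subseteq> closure (\<Inter>\<G>)"
  proof (rule Baire)
    fix T assume "T \<in> \<G>"
    then obtain N where "N \<in> \<N>" "T = - closure N" unfolding \<G>_def by blast
    then show "openin (top_of_set UNIV) T \<and> UNIV \<subseteq> closure T"
      using N(2) by (simp add: nowhere_dense_def closure_complement open_Compl)
  qed (use N in \<open>auto simp: \<G>_def\<close>)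
  then have "U \<inter> \<Inter>\<G> \<noteq> {}"
    using assms open_Int_closure_eq_empty[of U "\<Inter>\<G>"] by auto
  then obtain x where "x \<in> U" "x \<in> \<Inter>\<G>" by blast
  then show False
    using N(3) closure_subset unfolding \<G>_def by fastforce
qed

text \<open>If every \<open>A i\<close> were nowhere dense, \<open>X\<close> would be meager,
  against Baire's theorem. Stating \<open>cover\<close> as an implication lets the lemma serve
  countable families as well as families of fewer than continuum many sets.\<close>

lemma dense_member_of_cover:
  fixes X M :: "real set"
  assumes "open X" "X \<noteq> {}" "meager M" "X \<subseteq> M \<union> (\<Union>i\<in>I. A i)"
    and cover: "(\<And>i. i \<in> I \<Longrightarrow> nowhere_dense (A i)) \<Longrightarrow> meager (\<Union>i\<in>I. A i)"
    and sub: "\<And>i. i \<in> I \<Longrightarrow> A i \<subseteq> X"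
  obtains i J where "i \<in> I" "open J" "J \<noteq> {}" "J \<subseteq> X" "J \<subseteq> closure (A i)"
proof -
  obtain i where i: "i \<in> I" "\<not> nowhere_dense (A i)"
    using assms meager_Un meager_subset open_not_meager by metis
  define J where "J = interior (closure (A i)) \<inter> X"
  have "interior (closure (A i)) \<inter> closure (A i) \<noteq> {}"
    using i(2) interior_subset[of "closure (A i)"] unfolding nowhere_dense_def by blast
  then have "interior (closure (A i)) \<inter> A i \<noteq> {}"
    by (simp add: open_Int_closure_eq_empty)
  then have "J \<noteq> {}" using sub[OF i(1)] unfolding J_def by blast
  moreover have "J \<subseteq> closure (A i)"
    using interior_subset unfolding J_def by blast
  ultimately show ?thesis
    using that[of i J] i(1) assms(1) unfolding J_def by blast
qed

lemma nowhere_dense_translation: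
  fixes A :: "real set"
  assumes "nowhere_dense A"
  shows "nowhere_dense ((\<lambda>x. a + x) ` A)"
  using assms unfolding nowhere_dense_def
  by (simp add: closure_translation interior_translation)

lemma meager_translation:
  fixes A :: "real set"
  assumes "meager A"
  shows "meager ((\<lambda>x. a + x) ` A)"
proof -
  obtain \<N> where N: "countable \<N>" "\<forall>N\<in>\<N>. nowhere_dense N" "A = \<Union>\<N>"
    using assms unfolding meager_def by blast
  show ?thesis
    unfolding meager_def
    by (intro exI[of _ "(\<lambda>N. (\<lambda>x. a + x) ` N) ` \<N>"]) (use N nowhere_dense_translation in auto)
qed

lemma rational_absorbs:
  fixes y e :: real
  assumes "e > 0"
  obtains q :: rat where "q > 0" "\<bar>of_rat q * y\<bar> < e"
proof -
  obtain n :: nat where n: "\<bar>y\<bar> / e < of_nat n"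
    using reals_Archimedean2 by blast
  then have "n > 0" using assms by (metis abs_ge_zero divide_nonneg_pos less_le_not_le of_nat_0 neq0_conv)
  then have "\<bar>of_rat (1 / of_nat n) * y\<bar> < e"
    using n assms by (simp add: of_rat_divide field_simps abs_mult)
  then show ?thesis using that[of "1 / of_nat n"] \<open>n > 0\<close> by simp
qed

text \<open>Differences of points of an interval fill a neighbourhood of \<open>0\<close>, and
  rational scaling spreads that over the whole line.\<close>

lemma proper_span_interior:
  fixes T :: "real set"
  assumes "rat_span T \<noteq> UNIV" "A \<subseteq> rat_span T"
  shows "interior A = {}"
proof (rule ccontr)
  assume "interior A \<noteq> {}"
  then obtain x where "x \<in> interior A" by blast
  then obtain e where e: "e > 0" "ball x e \<subseteq> A"
    using mem_interior by blast
  have "y \<in> rat_span T" for y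
  proof -
    obtain q :: rat where q: "q > 0" "\<bar>of_rat q * y\<bar> < e"
      using rational_absorbs e(1) by blast
    then have "x + of_rat q * y \<in> A" "x \<in> A"
      using e by (auto simp: dist_real_def subset_iff)
    then have "(x + of_rat q * y) - x \<in> rat_span T"
      using assms(2) rat_vec.span_diff by blast
    then have "rat_scale (1 / q) (of_rat q * y) \<in> rat_span T"
      by (intro rat_vec.span_scale) auto
    then show ?thesis using q(1) by (simp add: of_rat_divide)
  qed
  then show False using assms(1) by blast
qed

text \<open>For a fixed list of rational coefficients the combinations of points of \<open>T\<close>
  form a compact set, which has empty interior inside a proper subspace. There are only countably
  many lists.\<close>

lemma meager_span_compact:
  fixes T :: "real set"
  assumes "compact T" "rat_span T \<noteq> UNIV"
  shows "meager (rat_span T)"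
proof -
  define Z where "Z = rec_list {0::real} (\<lambda>q _ X. {x + y | x y. x \<in> (\<lambda>t. of_rat q *\<^sub>R t) ` T \<and> y \<in> X})"
  have Z: "Z [] = {0}" "Z (q # qs) = {x + y | x y. x \<in> (\<lambda>t. of_rat q *\<^sub>R t) ` T \<and> y \<in> Z qs}" for q qs
    by (simp_all add: Z_def)
  have comp: "compact (Z qs)" for qs
    by (induction qs) (simp_all only: Z compact_sums compact_scaling assms(1) compact_sing)
  have sub: "Z qs \<subseteq> rat_span T" for qs
  proof (induction qs)
    case Nil
    then show ?case by (simp add: Z rat_vec.span_zero)
  next
    case (Cons q qs)
    have "of_rat q * t \<in> rat_span T" if "t \<in> T" for t
      using rat_vec.span_scale[OF rat_vec.span_base[OF that], of q] by simp
    then show ?case using Cons by (auto simp: Z intro!: rat_vec.span_add)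
  qed
  have "nowhere_dense (Z qs)" for qs
    unfolding nowhere_dense_def
    using proper_span_interior[OF assms(2) sub] compact_imp_closed[OF comp] by simp
  moreover have "rat_span T \<subseteq> (\<Union>qs. Z qs)"
  proof
    fix x assume "x \<in> rat_span T"
    then show "x \<in> (\<Union>qs. Z qs)"
    proof (induction rule: rat_vec.span_induct_alt)
      case base
      then show ?case using Z(1) by blast
    next
      case (step c x y)
      then obtain qs where "y \<in> Z qs" by blast
      then have "rat_scale c x + y \<in> Z (c # qs)" using step by (auto simp: Z)
      then show ?case by blast
    qed
  qed
  ultimately show ?thesis
    by (meson meager_subset meager_UN nowhere_dense_imp_meager countableI_type)
qed

section \<open>A compact family of rationally independent numbers\<close>

text \<open>Successive exponents differ by \<open>2 * j + 1\<close>. These growing gaps are what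
  defeats bounded integer coefficients: a vanishing series has only finitely many nonzero
  ones.\<close>

abbreviation lac :: "nat \<Rightarrow> real" where "lac j \<equiv> (1 / 2) ^ (j\<^sup>2)"

lemma lac_le: "lac (j + J) \<le> lac J * (1 / 2) ^ j"
proof -
  have "J\<^sup>2 + j \<le> (j + J)\<^sup>2"
    by (cases j) (auto simp: power2_eq_square algebra_simps)
  then show ?thesis
    by (simp add: power_decreasing flip: power_add)
qed

lemma summable_lac_bounded:
  fixes a :: "nat \<Rightarrow> real"
  assumes "\<And>j. \<bar>a j\<bar> \<le> M"
  shows "summable (\<lambda>j. a j * lac j)"
proof (rule summable_comparison_test')
  show "summable (\<lambda>j. M * (1 / 2) ^ j :: real)"
    by (intro summable_mult summable_geometric) auto
  show "norm (a j * lac j) \<le> M * (1 / 2) ^ j" for j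
    using assms[of j] lac_le[of j 0] by (auto simp: abs_mult intro!: mult_mono)
qed

text \<open>Scaled by the last denominator, a partial sum is an integer, and it is smaller than one
  because the remaining tail is.\<close>

lemma lacunary_int_series:
  fixes a :: "nat \<Rightarrow> int"
  assumes bound: "\<And>j. \<bar>a j\<bar> \<le> M" and zero: "(\<Sum>j. of_int (a j) * lac j) = 0"
  obtains J where "\<And>j. j \<ge> J \<Longrightarrow> a j = 0"
proof -
  define P where "P J = (\<Sum>j<J. of_int (a j) * lac j)" for J
  have bd: "\<bar>of_int (a j) :: real\<bar> \<le> of_int M" for j
    using bound[of j] by (metis of_int_abs of_int_le_iff)
  have sum: "summable (\<lambda>j. of_int (a j) * lac j)"
    using bd by (rule summable_lac_bounded)
  have P_le: "\<bar>P J\<bar> \<le> 2 * of_int M * lac J" for J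
  proof -
    have geo: "(\<lambda>j. of_int M * lac J * (1 / 2) ^ j) sums (of_int M * lac J * 2)"
      using sums_mult[OF geometric_sums[of "1 / 2 :: real"], of "of_int M * lac J"] by simp
    have le: "norm (of_int (a (j + J)) * lac (j + J)) \<le> of_int M * lac J * (1 / 2) ^ j" for j
    proof -
      have "norm (of_int (a (j + J)) * lac (j + J)) \<le> of_int M * (lac J * (1 / 2) ^ j)"
        unfolding real_norm_def abs_mult
        by (rule mult_mono) (use bd[of "j + J"] lac_le[of j J] bd[of 0] in auto)
      then show ?thesis by (simp add: mult.assoc)
    qed
    have "P J = - (\<Sum>j. of_int (a (j + J)) * lac (j + J))"
      using suminf_split_initial_segment[OF sum, of J] zero unfolding P_def by linarith
    also have "\<bar>\<dots>\<bar> \<le> (\<Sum>j. of_int M * lac J * (1 / 2) ^ j)"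
      using norm_suminf_le[OF le sums_summable[OF geo]] by simp
    also have "\<dots> = 2 * of_int M * lac J"
      using geo by (simp add: sums_iff)
    finally show ?thesis .
  qed
  \<comment> \<open>From \<open>K0\<close> on, the tail bound \<open>2 * M * lac (Suc K)\<close>,
    scaled by the denominator \<open>2 ^ (K\<^sup>2)\<close>, drops below one.\<close>
  obtain K0 :: nat where K0: "2 * of_int M < (2::real) ^ K0"
    using real_arch_pow[of 2 "2 * of_int M"] by auto
  have P0: "P (Suc K) = 0" if "K \<ge> K0" for K
  proof -
    have *: "2 ^ (K\<^sup>2) * (of_int (a j) * lac j) = of_int (a j * 2 ^ (K\<^sup>2 - j\<^sup>2))" if "j < Suc K" for j
    proof -
      have "j\<^sup>2 \<le> K\<^sup>2" using that by (simp add: power_mono)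
      then have "(2::real) ^ (K\<^sup>2) = 2 ^ (K\<^sup>2 - j\<^sup>2) * 2 ^ (j\<^sup>2)"
        by (simp flip: power_add)
      then show ?thesis by (simp add: power_one_over)
    qed
    have eq: "2 ^ (K\<^sup>2) * P (Suc K) = of_int (\<Sum>j<Suc K. a j * 2 ^ (K\<^sup>2 - j\<^sup>2))"
      unfolding P_def sum_distrib_left of_int_sum by (intro sum.cong refl *) auto
    have "\<bar>2 ^ (K\<^sup>2) * P (Suc K)\<bar> \<le> 2 ^ (K\<^sup>2) * (2 * of_int M * lac (Suc K))"
      using P_le[of "Suc K"] by (simp add: abs_mult)
    also have "\<dots> = 2 * of_int M / 2 ^ (2 * K + 1)"
    proof -
      have "(Suc K)\<^sup>2 = K\<^sup>2 + (2 * K + 1)" by (simp add: power2_eq_square)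
      then have "lac (Suc K) = 1 / (2 ^ (K\<^sup>2) * 2 ^ (2 * K + 1))"
        by (simp add: power_add power_one_over)
      then show ?thesis by simp
    qed
    also have "\<dots> < 1"
    proof -
      have "(2::real) ^ K0 \<le> 2 ^ (2 * K + 1)" using that by (intro power_increasing) auto
      then have "2 * of_int M < (2::real) ^ (2 * K + 1)" using K0 by linarith
      then show ?thesis by (subst divide_less_eq_1_pos) auto
    qed
    finally have "(\<Sum>j<Suc K. a j * 2 ^ (K\<^sup>2 - j\<^sup>2)) = 0"
      unfolding eq by linarith
    then show ?thesis using eq by simp
  qed
  \<comment> \<open>Two consecutive partial sums vanish, hence so does the term between
    them.\<close>
  have "a j = 0" if "j \<ge> Suc K0" for j
  proof -
    define K where "K = j - 1"
    have K: "j = Suc K" "K \<ge> K0" using that by (simp_all add: K_def)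
    have "P (Suc (Suc K)) = P (Suc K) + of_int (a j) * lac j" by (simp add: P_def K)
    then show ?thesis using P0[of K] P0[of "Suc K"] K by simp
  qed
  then show ?thesis using that by blast
qed

text \<open>The codes of the initial segments of \<open>b\<close>: the classical almost disjoint
  family of branches through the binary tree.\<close>

definition hit :: "(nat \<Rightarrow> bool) \<Rightarrow> nat \<Rightarrow> bool" where
  "hit b j \<longleftrightarrow> (\<exists>n. to_nat (map b [0..<n]) = j)"

definition seqnum :: "(nat \<Rightarrow> bool) \<Rightarrow> real" where
  "seqnum b = (\<Sum>j. of_bool (hit b j) * lac j)"

text \<open>The only candidate for \<open>n\<close> is the length of the list coded by
  \<open>j\<close>. So \<open>hit b j\<close> depends on finitely many entries of \<open>b\<close>,
  which makes \<open>seqnum\<close> continuous.\<close>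

lemma hit_iff: "hit b j \<longleftrightarrow> to_nat (map b [0..<length (from_nat j :: bool list)]) = j"
  unfolding hit_def by (metis from_nat_to_nat length_map length_upt diff_zero)

lemma seqnum_sums: "(\<lambda>j. of_bool (hit b j) * lac j) sums seqnum b"
  unfolding seqnum_def by (intro summable_sums summable_lac_bounded[where M = 1]) auto

lemma seqnum_bounds: "0 \<le> seqnum b" "seqnum b \<le> 2"
proof -
  show "0 \<le> seqnum b"
    unfolding seqnum_def by (intro suminf_nonneg) (use seqnum_sums sums_iff in auto)
  have "of_bool (hit b j) * lac j \<le> (1 / 2) ^ j" for j
    using lac_le[of j 0] by auto
  then show "seqnum b \<le> 2"
    using sums_le[OF _ seqnum_sums geometric_sums[of "1 / 2 :: real"]] by simp
qed

lemma common_denominator: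
  fixes u :: "'a \<Rightarrow> rat"
  assumes "finite B"
  shows "\<exists>N::int. N > 0 \<and> (\<forall>b\<in>B. \<exists>k::int. of_int N * u b = of_int k)"
  using assms
proof induction
  case empty
  then show ?case by (intro exI[of _ 1]) auto
next
  case (insert x B)
  then obtain N :: int where N: "N > 0" "\<forall>b\<in>B. \<exists>k::int. of_int N * u b = of_int k" by blast
  obtain p q :: int where pq: "q > 0" "u x = of_int p / of_int q"
    by (metis quotient_of_denom_pos quotient_of_div surj_pair)
  have "\<exists>k::int. of_int (N * q) * u b = of_int k" if "b \<in> insert x B" for b
  proof (cases "b = x")
    case True
    then have "of_int (N * q) * u b = of_int (N * p)" using pq by simp
    then show ?thesis by blast
  next
    case False
    then have "b \<in> B" using that by simp
    then obtain k :: int where k: "of_int N * u b = of_int k" using N(2) by blast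
    have "of_int (N * q) * u b = of_int q * (of_int N * u b)" by simp
    also have "\<dots> = of_int (q * k)" unfolding k by simp
    finally have "of_int (N * q) * u b = of_int (q * k)" .
    then show ?thesis by blast
  qed
  then show ?case using N(1) pq(1) by (intro exI[of _ "N * q"]) auto
qed

text \<open>Distinct sequences share only finitely many prefixes, so each of them eventually hits
  positions of its own.\<close>

lemma seqnum_relation:
  fixes u :: "(nat \<Rightarrow> bool) \<Rightarrow> rat"
  assumes fin: "finite B" and zero: "(\<Sum>b\<in>B. of_rat (u b) * seqnum b) = 0" and b: "b \<in> B"
  shows "u b = 0"
proof -
  obtain N :: int where N: "N > 0" "\<forall>b\<in>B. \<exists>k::int. of_int N * u b = of_int k"
    using common_denominator[OF fin] by blast
  then obtain k :: "(nat \<Rightarrow> bool) \<Rightarrow> int" where k: "\<And>b. b \<in> B \<Longrightarrow> of_int N * u b = of_int (k b)"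
    by metis
  define a where "a j = (\<Sum>c\<in>B. k c * of_bool (hit c j))" for j
  have "\<bar>a j\<bar> \<le> (\<Sum>c\<in>B. \<bar>k c\<bar>)" for j
    unfolding a_def by (intro order.trans[OF sum_abs] sum_mono) auto
  moreover have "(\<Sum>j. of_int (a j) * lac j) = 0"
  proof -
    have "(\<lambda>j. \<Sum>c\<in>B. of_int (k c) * (of_bool (hit c j) * lac j)) sums (\<Sum>c\<in>B. of_int (k c) * seqnum c)"
      by (intro sums_sum sums_mult seqnum_sums)
    moreover have "(\<Sum>c\<in>B. of_int (k c) * (of_bool (hit c j) * lac j)) = of_int (a j) * lac j" for j
      by (simp add: a_def sum_distrib_right algebra_simps)
    moreover have "(\<Sum>c\<in>B. of_int (k c) * seqnum c) = of_int N * (\<Sum>c\<in>B. of_rat (u c) * seqnum c)"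
    proof -
      have "(of_int (k c) :: real) = of_int N * of_rat (u c)" if "c \<in> B" for c
        using arg_cong[OF k[OF that], of "of_rat :: rat \<Rightarrow> real"] by (simp add: of_rat_mult)
      then show ?thesis by (simp add: sum_distrib_left algebra_simps)
    qed
    ultimately show ?thesis using zero by (simp add: sums_iff)
  qed
  ultimately obtain J where J: "\<And>j. j \<ge> J \<Longrightarrow> a j = 0"
    using lacunary_int_series by blast
  have "\<exists>m. \<forall>c\<in>B - {b}. \<forall>n\<ge>m. \<not> hit c (to_nat (map b [0..<n]))"
  proof -
    have "\<exists>m. c m \<noteq> b m" if "c \<in> B - {b}" for c using that by auto
    then obtain d where d: "\<And>c. c \<in> B - {b} \<Longrightarrow> c (d c) \<noteq> b (d c)" by metis
    define m where "m = Suc (Max (insert 0 (d ` (B - {b}))))"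
    have "\<not> hit c (to_nat (map b [0..<n]))" if c: "c \<in> B - {b}" and n: "n \<ge> m" for c n
    proof
      assume "hit c (to_nat (map b [0..<n]))"
      then obtain n' where eq: "map c [0..<n'] = map b [0..<n]"
        unfolding hit_def by auto
      then have "n' = n" by (metis length_map length_upt diff_zero)
      moreover have "d c < n"
      proof -
        have "d c \<le> Max (insert 0 (d ` (B - {b})))" using c fin by (intro Max_ge) auto
        then show ?thesis using n unfolding m_def by simp
      qed
      ultimately show False using eq d[OF c] by (auto simp: map_eq_conv)
    qed
    then show ?thesis by blast
  qed
  then obtain m where m: "\<And>c n. c \<in> B - {b} \<Longrightarrow> n \<ge> m \<Longrightarrow> \<not> hit c (to_nat (map b [0..<n]))"
    by blast
  have "inj (\<lambda>n. to_nat (map b [0..<n]))"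
    by (intro injI) (metis diff_zero from_nat_to_nat length_map length_upt)
  then have "infinite ((\<lambda>n. to_nat (map b [0..<n])) ` {m..})"
    by (meson finite_imageD inj_on_subset infinite_Ici subset_UNIV)
  then obtain n where n: "n \<ge> m" "to_nat (map b [0..<n]) \<ge> J"
    unfolding infinite_nat_iff_unbounded_le by auto
  define j where "j = to_nat (map b [0..<n])"
  \<comment> \<open>At this position only \<open>b\<close> contributes, so the coefficient of the
    series is that of \<open>b\<close> alone.\<close>
  have "a j = k b * of_bool (hit b j) + (\<Sum>c\<in>B - {b}. k c * of_bool (hit c j))"
    unfolding a_def by (rule sum.remove[OF fin b])
  also have "\<dots> = k b"
    using m n by (auto simp: j_def hit_def intro!: sum.neutral)
  finally have "k b = 0" using J n by (simp add: j_def)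
  then show ?thesis using k[OF b] N(1) by simp
qed

lemma inj_seqnum: "inj seqnum"
proof (rule injI, rule ccontr)
  fix b c :: "nat \<Rightarrow> bool"
  assume "seqnum b = seqnum c" "b \<noteq> c"
  then show False
    using seqnum_relation[of "{b, c}" "\<lambda>d. if d = b then 1 else -1" b] by simp
qed

text \<open>Nonzero rational factors can be absorbed into the coefficients of a relation. They are
  used later to move some of the numbers into prescribed intervals.\<close>

lemma seqnum_scaled_independent:
  fixes r :: "(nat \<Rightarrow> bool) \<Rightarrow> rat"
  assumes "\<And>b. r b \<noteq> 0"
  shows "\<not> rat_dependent (range (\<lambda>b. of_rat (r b) * seqnum b))" 
    and "inj (\<lambda>b. of_rat (r b) * seqnum b)"
proof -
  let ?v = "\<lambda>b. of_rat (r b) * seqnum b"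
  show inj: "inj ?v"
  proof (rule injI, rule ccontr)
    fix b c
    assume "?v b = ?v c" "b \<noteq> c"
    then show False
      using seqnum_relation[of "{b, c}" "\<lambda>d. if d = b then r b else - r c" b] assms[of b]
      by (simp add: of_rat_minus)
  qed
  have "u v = 0" if S: "S \<subseteq> range ?v" "finite S" and z: "(\<Sum>v\<in>S. rat_scale (u v) v) = 0"
    and v: "v \<in> S" for S u v
  proof -
    define B where "B = ?v -` S"
    have S_eq: "S = ?v ` B" using S(1) unfolding B_def by auto
    have "finite B" unfolding B_def using S(2) inj by (rule finite_vimageI)
    moreover have "(\<Sum>b\<in>B. of_rat (u (?v b) * r b) * seqnum b) = 0"
      using z unfolding S_eq
      by (subst (asm) sum.reindex) (use inj in \<open>auto simp: inj_on_def of_rat_mult algebra_simps\<close>)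
    moreover obtain b where "b \<in> B" "v = ?v b" using v S_eq by blast
    ultimately have "u v * r b = 0"
      using seqnum_relation[of B "\<lambda>b. u (?v b) * r b" b] by simp
    then show ?thesis using assms by simp
  qed
  then show "\<not> rat_dependent (range ?v)"
    unfolding rat_vec.independent_explicit_finite_subsets by blast
qed

section \<open>Compactness and limit points of the family\<close>

lemma continuous_on_finitely_determined:
  fixes F :: "(nat \<Rightarrow> bool) \<Rightarrow> real"
  assumes "\<And>b c. (\<And>i. i < n \<Longrightarrow> b i = c i) \<Longrightarrow> F b = F c"
  shows "continuous_on UNIV F"
  unfolding continuous_on_def
proof
  fix b :: "nat \<Rightarrow> bool"
  define U where "U = {c::nat \<Rightarrow> bool. \<forall>i\<in>{..<n}. c i \<in> {b i}}"
  have "open U"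
    unfolding U_def using product_topology_basis'[of "{..<n}" "\<lambda>i. {b i}" "\<lambda>i. i"]
    by (auto simp: open_discrete)
  moreover have "b \<in> U" by (simp add: U_def)
  ultimately have "\<forall>\<^sub>F c in at b within UNIV. F c = F b"
    unfolding eventually_at_topological
  proof (intro exI conjI ballI impI)
    fix c assume "c \<in> U"
    then show "F c = F b" by (intro assms) (auto simp: U_def)
  qed
  then show "(F \<longlongrightarrow> F b) (at b within UNIV)" by (rule tendsto_eventually)
qed

lemma continuous_on_seqnum: "continuous_on UNIV seqnum"
proof (rule uniform_limit_theorem)
  show "uniform_limit UNIV (\<lambda>n b. \<Sum>j<n. of_bool (hit b j) * lac j) seqnum sequentially"
    unfolding seqnum_def
    by (rule Weierstrass_m_test[where M = lac])
       (use summable_lac_bounded[of "\<lambda>_. 1" 1] in auto)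
  have "continuous_on UNIV (\<lambda>b. of_bool (hit b j) :: real)" for j
  proof (rule continuous_on_finitely_determined)
    fix b c :: "nat \<Rightarrow> bool"
    assume "\<And>i. i < length (from_nat j :: bool list) \<Longrightarrow> b i = c i"
    then have "map b [0..<length (from_nat j :: bool list)] = map c [0..<length (from_nat j :: bool list)]"
      by simp
    then show "of_bool (hit b j) = (of_bool (hit c j) :: real)"
      unfolding hit_iff by (rule arg_cong[where f = "\<lambda>l. of_bool (to_nat l = j)"])
  qed
  then show "\<forall>\<^sub>F n in sequentially. continuous_on UNIV (\<lambda>b. \<Sum>j<n. of_bool (hit b j) * lac j)"
    by (intro always_eventually allI continuous_intros)
qed simp

text \<open>\<open>A\<close> may be infinite: infinitely many fixed entries can encode a set of
  naturals while infinitely many free ones still leave a perfect set.\<close>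

definition cylinder :: "nat set \<Rightarrow> (nat \<Rightarrow> bool) \<Rightarrow> (nat \<Rightarrow> bool) set" where
  "cylinder A c = {b. \<forall>i\<in>A. b i = c i}"

lemma compact_seqnum_cylinder: "compact (seqnum ` cylinder A c)"
proof (rule compact_continuous_image)
  have "cylinder A c = PiE UNIV (\<lambda>i. if i \<in> A then {c i} else UNIV)"
    by (auto simp: cylinder_def PiE_iff split: if_splits)
  moreover have "compactin (product_topology (\<lambda>i::nat. euclidean :: bool topology) UNIV)
      (PiE UNIV (\<lambda>i. if i \<in> A then {c i} else UNIV))"
    unfolding compactin_PiE by (auto simp: finite_imp_compact)
  ultimately show "compact (cylinder A c)"
    by (simp add: euclidean_product_topology)
qed (rule continuous_on_subset[OF continuous_on_seqnum], simp)

text \<open>Flipping one free entry, further and further out, gives other members of the cylinder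
  that converge to the given one.\<close>

lemma seqnum_cylinder_islimpt:
  assumes inf: "infinite (- A)" and x: "x \<in> seqnum ` cylinder A c"
  shows "x islimpt seqnum ` cylinder A c"
proof -
  obtain b where b: "b \<in> cylinder A c" "x = seqnum b" using x by blast
  have "\<exists>i. i \<ge> n \<and> i \<notin> A" for n
    using inf infinite_nat_iff_unbounded_le[of "- A"] by blast
  then obtain i where i: "\<And>n. i n \<ge> n" "\<And>n. i n \<notin> A" by metis
  define b' where "b' n = b(i n := \<not> b (i n))" for n
  have b': "b' n \<in> cylinder A c" "b' n \<noteq> b" for n
  proof -
    show "b' n \<in> cylinder A c" using b(1) i(2)[of n] by (auto simp: b'_def cylinder_def)
    have "b' n (i n) \<noteq> b (i n)" by (simp add: b'_def)
    then show "b' n \<noteq> b" by metis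
  qed
  have "((\<lambda>n. b' n j) \<longlongrightarrow> b j) sequentially" for j
  proof (rule tendsto_eventually)
    have "b' n j = b j" if "n \<ge> Suc j" for n
      using i(1)[of n] that by (auto simp: b'_def)
    then show "\<forall>\<^sub>F n in sequentially. b' n j = b j"
      unfolding eventually_sequentially by blast
  qed
  then have "limitin (product_topology (\<lambda>i::nat. euclidean :: bool topology) UNIV) b' b sequentially"
    unfolding limitin_componentwise by simp
  then have "b' \<longlonglongrightarrow> b"
    unfolding euclidean_product_topology by simp
  then have "(\<lambda>n. seqnum (b' n)) \<longlonglongrightarrow> seqnum b"
    by (rule continuous_on_tendsto_compose[OF continuous_on_seqnum]) auto
  moreover have "seqnum (b' n) \<noteq> seqnum b" for n
    using b'(2) inj_seqnum by (auto dest: injD)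
  ultimately show ?thesis
    unfolding islimpt_sequential b(2) using b'(1) by (intro exI[of _ "\<lambda>n. seqnum (b' n)"]) auto
qed

section \<open>The barrier\<close>

definition left_lim :: "(real \<Rightarrow> real) \<Rightarrow> real \<Rightarrow> real" where
  "left_lim m x = (SUP z\<in>{..<x}. m z)"

definition right_lim :: "(real \<Rightarrow> real) \<Rightarrow> real \<Rightarrow> real" where
  "right_lim m x = (INF z\<in>{x<..}. m z)"

text \<open>The poles do two things: they make the barrier closed although it lies over an open
  interval, and they force every continuous function to start below it and to end above it.\<close>

definition drift :: "real \<Rightarrow> real" where
  "drift x = 1 / x - 1 / (1 - x)"

text \<open>Filling in the vertical segments at the jumps would give a curve that separates the strip. When
  the jumps are dense the set without them contains no nontrivial connected piece, and still a
  continuous function cannot get across it from below.\<close>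

definition barrier :: "(real \<Rightarrow> real) \<Rightarrow> (real \<times> real) set" where
  "barrier m = {(x, y). 0 < x \<and> x < 1 \<and> (y = drift x + left_lim m x \<or> y = drift x + right_lim m x)}"

lemma isCont_drift: "0 < x \<Longrightarrow> x < 1 \<Longrightarrow> isCont drift x"
  unfolding drift_def by (intro continuous_intros) auto

locale bounded_mono =
  fixes m :: "real \<Rightarrow> real" and B :: real
  assumes mono: "mono m" and ge_0: "\<And>x. 0 \<le> m x" and le_B: "\<And>x. m x \<le> B"
begin

abbreviation "L \<equiv> left_lim m"
abbreviation "R \<equiv> right_lim m"

lemma bdd: "bdd_above (m ` S)" "bdd_below (m ` S)"
  using le_B ge_0 unfolding bdd_above_def bdd_below_def by blast+

lemma le_L: "z < x \<Longrightarrow> m z \<le> L x"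
  unfolding left_lim_def by (intro cSUP_upper bdd) auto

lemma R_le: "x < z \<Longrightarrow> R x \<le> m z"
  unfolding right_lim_def by (intro cINF_lower bdd) auto

lemma L_le: "L x \<le> m x"
  unfolding left_lim_def using mono by (intro cSUP_least) (auto simp: mono_def)

lemma le_R: "m x \<le> R x"
  unfolding right_lim_def using mono by (intro cINF_greatest) (auto simp: mono_def)

lemma R_le_L: "x < z \<Longrightarrow> R x \<le> L z"
  using R_le[of x "(x + z) / 2"] le_L[of "(x + z) / 2" z] by simp

lemma less_L: "y < L x \<Longrightarrow> \<exists>z<x. y < m z"
  unfolding left_lim_def using less_cSUP_iff[of "{..<x}" m y] bdd by auto

lemma R_less: "R x < y \<Longrightarrow> \<exists>z>x. m z < y"
  unfolding right_lim_def using cINF_less_iff[of "{x<..}" m y] bdd by auto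

lemma barrier_section_bounds:
  assumes "(x, y) \<in> barrier m"
  shows "drift x + L x \<le> y" "y \<le> drift x + R x" "0 < x" "x < 1"
  using assms order.trans[OF L_le[of x] le_R[of x]] by (auto simp: barrier_def)

lemma L_ge_0: "0 \<le> L x"
  using ge_0 le_L[of "x - 1" x] by (meson order.trans less_add_one diff_less_eq)

lemma R_le_B: "R x \<le> B"
  using le_B R_le[of x "x + 1"] by (meson order.trans less_add_one)

text \<open>This makes the complement an open neighbourhood of the graph of any function that avoids
  the barrier. The poles exclude limits over the end points; elsewhere monotonicity confines a limit
  to the two ends of the jump.\<close>

lemma closed_barrier: "closed (barrier m)"
  unfolding closed_sequential_limits
proof (intro allI impI, elim conjE)
  fix p l
  assume p: "\<forall>n. p n \<in> barrier m" and lim: "p \<longlonglongrightarrow> l"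
  obtain x y where l: "l = (x, y)" by fastforce
  define X Y where "X n = fst (p n)" and "Y n = snd (p n)" for n
  have in_b: "(X n, Y n) \<in> barrier m" for n using p by (simp add: X_def Y_def)
  have X: "X \<longlonglongrightarrow> x" and Y: "Y \<longlonglongrightarrow> y"
    using tendsto_fst[OF lim] tendsto_snd[OF lim] by (simp_all add: l X_def[abs_def] Y_def[abs_def])
  define u where "u n = Y n - drift (X n)" for n
  have u: "L (X n) \<le> u n" "u n \<le> R (X n)" "u n = L (X n) \<or> u n = R (X n)" for n
    using barrier_section_bounds[OF in_b[of n]] in_b[of n] by (auto simp: u_def barrier_def)
  have X01: "0 < X n" "X n < 1" for n using barrier_section_bounds[OF in_b[of n]] by auto
  have "0 \<le> x" by (rule LIMSEQ_le_const[OF X]) (use X01 less_imp_le in blast)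
  have "x \<le> 1" by (rule LIMSEQ_le_const2[OF X]) (use X01 less_imp_le in blast)
  have "x * (1 - x) \<noteq> 0"
  proof
    assume x: "x * (1 - x) = 0"
    \<comment> \<open>Multiplying by \<open>X n * (1 - X n)\<close> removes the poles. Over an end
      point the left side would tend to 0, the right side to 1 or -1.\<close>
    have "X n * (1 - X n) * Y n - X n * (1 - X n) * u n = 1 - 2 * X n" for n
    proof -
      have "X n * (1 - X n) * drift (X n) = 1 - 2 * X n"
        using X01[of n] by (simp add: drift_def field_simps)
      then show ?thesis by (simp add: u_def algebra_simps)
    qed
    moreover have "(\<lambda>n. X n * (1 - X n) * Y n) \<longlonglongrightarrow> x * (1 - x) * y"
      by (intro tendsto_intros X Y)
    moreover have "(\<lambda>n. X n * (1 - X n) * u n) \<longlonglongrightarrow> 0"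
    proof (rule Lim_null_comparison)
      have "norm (X n * (1 - X n) * u n) \<le> X n * (1 - X n) * B" for n
      proof -
        have "0 \<le> u n" "u n \<le> B" using u[of n] L_ge_0[of "X n"] R_le_B[of "X n"] by linarith+
        then show ?thesis using X01[of n] by (simp add: abs_mult mult_left_mono)
      qed
      then show "\<forall>\<^sub>F n in sequentially. norm (X n * (1 - X n) * u n) \<le> X n * (1 - X n) * B"
        by simp
      have "(\<lambda>n. X n * (1 - X n) * B) \<longlonglongrightarrow> x * (1 - x) * B" by (intro tendsto_intros X)
      then show "(\<lambda>n. X n * (1 - X n) * B) \<longlonglongrightarrow> 0" using x by simp
    qed
    ultimately have "(\<lambda>n. 1 - 2 * X n) \<longlonglongrightarrow> x * (1 - x) * y - 0"
      using tendsto_diff by fastforce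
    moreover have "(\<lambda>n. 1 - 2 * X n) \<longlonglongrightarrow> 1 - 2 * x" by (intro tendsto_intros X)
    ultimately have "1 - 2 * x = 0" using x LIMSEQ_unique by fastforce
    then show False using x by auto
  qed
  then have x01: "0 < x" "x < 1" using \<open>0 \<le> x\<close> \<open>x \<le> 1\<close> by (auto simp: less_le)
  define v where "v = y - drift x"
  have u_lim: "u \<longlonglongrightarrow> v"
    unfolding u_def[abs_def] v_def using isCont_tendsto_compose[OF isCont_drift[OF x01] X] Y
    by (intro tendsto_intros)
  have "L x \<le> v"
  proof (rule ccontr)
    assume "\<not> L x \<le> v"
    then obtain z where z: "z < x" "v < m z" using less_L by (meson not_le)
    have "\<forall>\<^sub>F n in sequentially. m z \<le> u n"
      using order_tendstoD(1)[OF X z(1)]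
      by eventually_elim (use u(1) le_L order.trans in blast)
    then have "m z \<le> v" using tendsto_lowerbound[OF u_lim] by simp
    then show False using z by simp
  qed
  moreover have "v \<le> R x"
  proof (rule ccontr)
    assume "\<not> v \<le> R x"
    then obtain z where z: "z > x" "m z < v" using R_less by (meson not_le)
    have "\<forall>\<^sub>F n in sequentially. u n \<le> m z"
      using order_tendstoD(2)[OF X z(1)]
      by eventually_elim (use u(2) R_le order.trans in blast)
    then have "v \<le> m z" using tendsto_upperbound[OF u_lim] by simp
    then show False using z by simp
  qed
  \<comment> \<open>After subtraction of the drift, sections left of \<open>x\<close> stay at or
    below \<open>L x\<close> and those right of \<open>x\<close> at or above \<open>R x\<close>. The
    inside of the jump could be approached only over \<open>x\<close> itself, where just its two
    ends occur.\<close>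
  moreover have "\<not> (L x < v \<and> v < R x)"
  proof
    assume v: "L x < v \<and> v < R x"
    then have "\<forall>\<^sub>F n in sequentially. L x < u n \<and> u n < R x"
      using order_tendstoD[OF u_lim] by (simp add: eventually_conj)
    then obtain n where n: "L x < u n" "u n < R x"
      using eventually_happens trivial_limit_sequentially by blast
    have "\<not> X n < x" using R_le_L[of "X n" x] u(2)[of n] n by linarith
    moreover have "\<not> x < X n" using R_le_L[of x "X n"] u(1)[of n] n by linarith
    ultimately have "X n = x" by simp
    then show False using u(3)[of n] n by auto
  qed
  ultimately show "l \<in> barrier m"
    using x01 unfolding l v_def barrier_def by force
qed

text \<open>Above the last point where a continuous function is below the barrier it stays above, and at
  that point an upward jump would have to be crossed in the wrong direction.\<close>

lemma barrier_meets_continuous: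
  assumes g: "continuous_on UNIV g"
  shows "\<exists>x. (x, g x) \<in> barrier m"
proof -
  define h where "h x = g x - drift x" for x
  have h_cont: "isCont h x" if "0 < x" "x < 1" for x
    unfolding h_def using g isCont_drift[OF that]
    by (intro continuous_intros) (auto simp: continuous_on_eq_continuous_at)
  have "compact (g ` {0..1})"
    by (intro compact_continuous_image continuous_on_subset[OF g]) auto
  then obtain G where G: "\<And>x. x \<in> {0..1} \<Longrightarrow> \<bar>g x\<bar> \<le> G"
    using compact_imp_bounded bounded_iff by (metis imageI real_norm_def)
  have "0 \<le> G" using G[of 0] by simp
  have "0 \<le> B" using ge_0 le_B order.trans by blast
  \<comment> \<open>At distance at most \<open>e\<close> from an end one pole is at least
    \<open>G + B + 3\<close> while the other term is at most 2, so the sign of \<open>h\<close>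
    relative to \<open>0\<close> and \<open>B\<close> is decided.\<close>
  define e where "e = 1 / (G + B + 3)"
  have e: "0 < e" "e \<le> 1/3" "1 / e = G + B + 3"
    using \<open>0 \<le> G\<close> \<open>0 \<le> B\<close> by (simp_all add: e_def field_simps)
  define A where "A = {x. 0 < x \<and> x < 1 \<and> h x < m x}"
  have "e \<in> A"
  proof -
    have "1 / (1 - e) \<le> 2" using e by (simp add: field_simps)
    then have "h e < 0" using G[of e] e \<open>0 \<le> B\<close> unfolding h_def drift_def by auto
    then show ?thesis using e ge_0[of e] unfolding A_def by auto
  qed
  have above: "m x < h x" if "1 - e \<le> x" "x < 1" for x
  proof -
    have "1 / e \<le> 1 / (1 - x)" using that e by (intro divide_left_mono) auto
    moreover have "1 / x \<le> 2" using that e by (simp add: field_simps)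
    ultimately have "B < h x" using G[of x] that e unfolding h_def drift_def by auto
    then show ?thesis using le_B[of x] by linarith
  qed
  have A_le: "x \<le> 1 - e" if "x \<in> A" for x
    using above[of x] that unfolding A_def by force
  then have bdd_A: "bdd_above A" unfolding bdd_above_def by blast
  define s where "s = Sup A"
  have "e \<le> s" unfolding s_def using \<open>e \<in> A\<close> bdd_A by (rule cSup_upper)
  moreover have "s \<le> 1 - e" unfolding s_def using \<open>e \<in> A\<close> A_le by (intro cSup_least) auto
  ultimately have s01: "0 < s" "s < 1" using e by auto
  have hs: "h \<midarrow>s\<rightarrow> h s" using h_cont[OF s01] by (simp add: isCont_def)
  have "R s \<le> h s"
  proof (rule tendsto_lowerbound)
    show "(h \<longlongrightarrow> h s) (at_right s)" using hs by (rule filterlim_at_split[THEN iffD1, THEN conjunct2])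
    have "R s \<le> h x" if "s < x" "x < 1" for x
    proof -
      have "x \<notin> A" using that bdd_A cSup_upper[of x A] unfolding s_def by auto
      then show ?thesis using that s01 R_le[of s x] unfolding A_def by auto
    qed
    then show "\<forall>\<^sub>F x in at_right s. R s \<le> h x"
      unfolding eventually_at_right_field using s01 by blast
  qed simp
  moreover have "h s \<le> L s"
  proof (rule ccontr)
    assume "\<not> h s \<le> L s"
    then have "\<forall>\<^sub>F x in at s. L s < h x" using order_tendstoD(1)[OF hs] by simp
    then obtain \<delta> where \<delta>: "\<delta> > 0" "\<And>x. x \<noteq> s \<Longrightarrow> dist x s < \<delta> \<Longrightarrow> L s < h x"
      unfolding eventually_at by auto
    have "s \<notin> A" using \<open>R s \<le> h s\<close> le_R[of s] unfolding A_def by auto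
    obtain x where x: "x \<in> A" "s - \<delta> < x"
      using less_cSup_iff[OF _ bdd_A, of "s - \<delta>"] \<delta>(1) \<open>e \<in> A\<close> unfolding s_def by auto
    then have "x < s"
      using \<open>s \<notin> A\<close> cSup_upper[OF x(1) bdd_A] unfolding s_def by (metis less_le)
    then have "L s < h x" using \<delta>(2)[of x] x by (auto simp: dist_real_def)
    moreover have "h x < m x" using x unfolding A_def by auto
    ultimately show False using le_L[OF \<open>x < s\<close>] by simp
  qed
  \<comment> \<open>The two bounds run against \<open>L s \<le> R s\<close>, so \<open>m\<close> has
    no jump at \<open>s\<close> and all three values agree.\<close>
  ultimately have "h s = L s" using order.trans[OF L_le[of s] le_R[of s]] by linarith
  then have "(s, g s) \<in> barrier m" using s01 by (simp add: barrier_def h_def)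
  then show ?thesis by blast
qed

text \<open>Close to \<open>d\<close> the drift varies by less than the margin that \<open>y\<close>
  leaves inside the jump, and monotonicity keeps the two sides of the barrier apart by the whole
  jump.\<close>

lemma barrier_gap:
  assumes d: "0 < d" "d < 1" and y: "drift d + L d < y" "y < drift d + R d"
  shows "\<exists>\<epsilon>>0. (\<forall>x k. d - \<epsilon> < x \<longrightarrow> x < d \<longrightarrow> (x, k) \<in> barrier m \<longrightarrow> k < y) \<and>
     (\<forall>x k. d < x \<longrightarrow> x < d + \<epsilon> \<longrightarrow> (x, k) \<in> barrier m \<longrightarrow> y < k)"
proof -
  define \<eta> where "\<eta> = min (y - (drift d + L d)) (drift d + R d - y)"
  have "\<eta> > 0" using y by (simp add: \<eta>_def)
  then obtain \<epsilon> where \<epsilon>: "\<epsilon> > 0" "\<And>x. \<bar>x - d\<bar> < \<epsilon> \<Longrightarrow> \<bar>drift x - drift d\<bar> < \<eta>"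
    using isCont_drift[OF d] unfolding continuous_at_eps_delta dist_real_def by metis
  have "k < y" if "d - \<epsilon> < x" "x < d" "(x, k) \<in> barrier m" for x k
    using barrier_section_bounds(2)[OF that(3)] R_le_L[OF that(2)] \<epsilon>(2)[of x] that
    unfolding \<eta>_def by linarith
  moreover have "y < k" if "d < x" "x < d + \<epsilon>" "(x, k) \<in> barrier m" for x k
    using barrier_section_bounds(1)[OF that(3)] R_le_L[OF that(1)] \<epsilon>(2)[of x] that
    unfolding \<eta>_def by linarith
  ultimately show ?thesis using \<epsilon>(1) by blast
qed

end

text \<open>A sum of unit steps at \<open>d n\<close> with weight \<open>(1 / 2) ^ n\<close>: the
  total weight gives the bound 2, and the jump at \<open>d n\<close> is at least its own
  weight.\<close>

lemma jump_function:
  fixes d :: "nat \<Rightarrow> real"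
  obtains m where "bounded_mono m 2" "\<And>n. left_lim m (d n) < right_lim m (d n)"
proof -
  define m where "m x = (\<Sum>n. of_bool (d n \<le> x) * (1 / 2 :: real) ^ n)" for x
  have geo: "(\<lambda>n. (1 / 2 :: real) ^ n) sums 2"
    using geometric_sums[of "1 / 2 :: real"] by simp
  have summ: "summable (\<lambda>n. of_bool (d n \<le> x) * (1 / 2 :: real) ^ n)" for x
    by (rule summable_comparison_test'[OF sums_summable[OF geo]]) auto
  interpret bounded_mono m 2
  proof
    show "mono m"
      unfolding mono_def m_def
    proof (intro allI impI suminf_le summ)
      fix x z :: real and n
      assume "x \<le> z"
      then show "of_bool (d n \<le> x) * (1 / 2 :: real) ^ n \<le> of_bool (d n \<le> z) * (1 / 2) ^ n"
        by (auto intro: mult_right_mono)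
    qed
    show "0 \<le> m x" for x unfolding m_def by (intro suminf_nonneg summ) auto
    show "m x \<le> 2" for x
      unfolding m_def using suminf_le[OF _ summ sums_summable[OF geo]] geo by (simp add: sums_iff)
  qed
  have "left_lim m (d n) < right_lim m (d n)" for n
  proof -
    have "m z \<le> m (d n) - (1 / 2) ^ n" if "z < d n" for z
    proof -
      have single: "(\<lambda>k. of_bool (k = n) * (1 / 2 :: real) ^ k) sums (1 / 2) ^ n"
        using sums_single[of n "\<lambda>k. (1 / 2 :: real) ^ k"]
        by (simp add: of_bool_def if_distrib[of "\<lambda>r. r * _"] cong: if_cong)
      have "m z + (1 / 2) ^ n = (\<Sum>k. of_bool (d k \<le> z) * (1 / 2) ^ k + of_bool (k = n) * (1 / 2) ^ k)"
        unfolding m_def using suminf_add[OF summ sums_summable[OF single]] single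
        by (simp add: sums_iff)
      also have "\<dots> \<le> m (d n)"
        unfolding m_def
      proof (intro suminf_le summ summable_add sums_summable[OF single])
        fix k
        show "of_bool (d k \<le> z) * (1 / 2 :: real) ^ k + of_bool (k = n) * (1 / 2) ^ k
           \<le> of_bool (d k \<le> d n) * (1 / 2) ^ k"
          using that by (cases "k = n") (auto intro: mult_right_mono)
      qed
      finally show ?thesis by simp
    qed
    then have "left_lim m (d n) \<le> m (d n) - (1 / 2) ^ n"
      unfolding left_lim_def by (intro cSUP_least) auto
    then show ?thesis using le_R[of "d n"] by (smt (verit) zero_less_power zero_less_divide_1_iff)
  qed
  then show ?thesis using that bounded_mono_axioms by blast
qed

section \<open>Partial additive functions\<close>

text \<open>An open set is determined by the members of a countable basis inside it. This bounds the
  number of tasks in the recursion.\<close>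

lemma open_sets_lepoll_real: "{U :: 'a::second_countable_topology set. open U} \<lesssim> (UNIV :: real set)"
proof -
  obtain \<B> :: "'a set set" where B: "countable \<B>" "topological_basis \<B>"
    using ex_countable_basis by blast
  define code where "code U = {n. from_nat_into \<B> n \<in> \<B> \<and> from_nat_into \<B> n \<subseteq> U}" for U
  have "inj_on code {U. open U}"
  proof (rule inj_onI)
    fix U V assume "U \<in> {U. open U}" "V \<in> {U. open U}" and eq: "code U = code V"
    then have o: "open U" "open V" by auto
    have "C \<subseteq> U \<longleftrightarrow> C \<subseteq> V" if "C \<in> \<B>" for C
      using that eq from_nat_into_surj[OF B(1) that] unfolding code_def by blast
    then have "{C \<in> \<B>. C \<subseteq> U} = {C \<in> \<B>. C \<subseteq> V}" by blast
    moreover have "W = \<Union>{C \<in> \<B>. C \<subseteq> W}" if "open W" for W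
    proof -
      have "\<exists>C\<in>\<B>. x \<in> C \<and> C \<subseteq> W" if "x \<in> W" for x
        using topological_basisE[OF B(2) \<open>open W\<close> that] by metis
      then show ?thesis by blast
    qed
    ultimately show "U = V" using o by metis
  qed
  then have "{U :: 'a set. open U} \<lesssim> (UNIV :: nat set set)"
    unfolding lepoll_def by blast
  then show ?thesis using nat_sets_eqpoll_reals lepoll_trans2 by blast
qed

lemma open_interval_lepoll:
  fixes a b :: real
  assumes "a < b"
  shows "(UNIV :: real set) \<lesssim> {a<..<b}"
proof -
  have "perfect_set {(2 * a + b) / 3..(a + 2 * b) / 3}"
    unfolding perfect_set_def using assms by (auto simp: islimpt_Icc)
  then have "(UNIV :: real set) \<lesssim> {(2 * a + b) / 3..(a + 2 * b) / 3}"
    using assms by (intro perfect_set_lepoll) auto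
  also have "\<dots> \<lesssim> {a<..<b}" using assms by (intro subset_imp_lepoll) auto
  finally show ?thesis .
qed

text \<open>The boundary between \<open>U\<close> and \<open>V\<close> has fewer than continuum many points, so it is not perfect;
  near an isolated point of it the two sets lie on different sides.\<close>

lemma isolated_switch:
  fixes U V :: "real set"
  assumes o: "open U" "open V" and disj: "U \<inter> V = {}" and ne: "U \<noteq> {}" "V \<noteq> {}"
    and small: "- (U \<union> V) \<prec> (UNIV :: real set)"
  obtains p q where "p \<in> \<rat>" "q \<in> \<rat>" "U \<inter> {p<..<q} \<noteq> {}" "V \<inter> {p<..<q} \<noteq> {}"
    "(\<forall>u\<in>U \<inter> {p<..<q}. \<forall>v\<in>V \<inter> {p<..<q}. u < v) \<or>
     (\<forall>u\<in>U \<inter> {p<..<q}. \<forall>v\<in>V \<inter> {p<..<q}. v < u)"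
proof -
  define Y where "Y = closure U \<inter> closure V"
  have cover: "closure U \<union> closure V = UNIV"
  proof (rule ccontr)
    assume "closure U \<union> closure V \<noteq> UNIV"
    then obtain x where x: "x \<in> - (closure U \<union> closure V)" by blast
    moreover have "open (- (closure U \<union> closure V))" by (intro open_Compl closed_Un) auto
    ultimately obtain e where e: "e > 0" "ball x e \<subseteq> - (closure U \<union> closure V)"
      using open_contains_ball by blast
    have "(UNIV :: real set) \<lesssim> {x - e<..<x + e}" using e(1) by (intro open_interval_lepoll) auto
    also have "{x - e<..<x + e} \<lesssim> - (U \<union> V)"
      using e(2) closure_subset[of U] closure_subset[of V]
      unfolding ball_eq_greaterThanLessThan by (intro subset_imp_lepoll) blast
    finally show False using small not_lepoll_iff_lesspoll by blast
  qed
  have YF: "Y \<subseteq> - (U \<union> V)"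
    unfolding Y_def using o disj open_Int_closure_eq_empty[of U V] open_Int_closure_eq_empty[of V U] by blast
  have sep: "S \<inter> Y \<noteq> {}" if "connected S" "S \<inter> U \<noteq> {}" "S \<inter> V \<noteq> {}" for S
  proof
    assume "S \<inter> Y = {}"
    then have "closure U \<inter> closure V \<inter> S = {}" unfolding Y_def by blast
    moreover have "closure U \<inter> S \<noteq> {}" "closure V \<inter> S \<noteq> {}"
      using that closure_subset[of U] closure_subset[of V] by blast+
    moreover have "S \<subseteq> closure U \<union> closure V" using cover by simp
    ultimately show False
      using \<open>connected S\<close> closed_closure[of U] closed_closure[of V] unfolding connected_closed by metis
  qed
  have "Y \<noteq> {}" using sep[of UNIV] ne by auto
  moreover have "\<not> (UNIV :: real set) \<lesssim> Y"
    using small YF by (meson lepoll_trans not_lepoll_iff_lesspoll subset_imp_lepoll)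
  ultimately have "\<not> perfect_set Y" using perfect_set_lepoll by blast
  then obtain y where y: "y \<in> Y" "\<not> y islimpt Y"
    unfolding perfect_set_def Y_def by blast
  then obtain e where e: "e > 0" "\<And>z. z \<in> Y \<Longrightarrow> z \<noteq> y \<Longrightarrow> e \<le> \<bar>z - y\<bar>"
    unfolding islimpt_approachable dist_real_def by (meson not_le)
  \<comment> \<open>Rational end points leave only countably many strips to choose from when
    \<open>x\<close> varies.\<close>
  obtain p where p: "p \<in> \<rat>" "y - e < p" "p < y" using Rats_dense_in_real[of "y - e" y] e by auto
  obtain q where q: "q \<in> \<rat>" "y < q" "q < y + e" using Rats_dense_in_real[of y "y + e"] e by auto
  \<comment> \<open>An interval that meets both sets contains a point of \<open>Y\<close>, and
    \<open>y\<close> is the only one nearby.\<close>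
  have no: "\<not> (S \<inter> U \<noteq> {} \<and> S \<inter> V \<noteq> {})" if "S = {p<..<y} \<or> S = {y<..<q}" for S
  proof
    assume "S \<inter> U \<noteq> {} \<and> S \<inter> V \<noteq> {}"
    moreover have "connected S" using that by auto
    ultimately obtain z where "z \<in> S" "z \<in> Y" using sep by blast
    then show False using e(2)[of z] that p q by auto
  qed
  have "y \<notin> U" "y \<notin> V" using y(1) YF by auto
  have meet: "U \<inter> {p<..<q} \<noteq> {}" "V \<inter> {p<..<q} \<noteq> {}"
  proof -
    have "{p<..<q} \<inter> closure U \<noteq> {}" "{p<..<q} \<inter> closure V \<noteq> {}"
      using y(1) p q unfolding Y_def by auto
    then have "{p<..<q} \<inter> U \<noteq> {}" "{p<..<q} \<inter> V \<noteq> {}"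
      by (simp_all add: open_Int_closure_eq_empty)
    then show "U \<inter> {p<..<q} \<noteq> {}" "V \<inter> {p<..<q} \<noteq> {}"
      by (simp_all add: Int_commute)
  qed
  have split: "{p<..<q} = {p<..<y} \<union> {y} \<union> {y<..<q}" using p q by auto
  have "(U \<inter> {p<..<q} \<subseteq> {p<..<y} \<and> V \<inter> {p<..<q} \<subseteq> {y<..<q}) \<or>
        (V \<inter> {p<..<q} \<subseteq> {p<..<y} \<and> U \<inter> {p<..<q} \<subseteq> {y<..<q})"
    using no[of "{p<..<y}"] no[of "{y<..<q}"] meet \<open>y \<notin> U\<close> \<open>y \<notin> V\<close> unfolding split by blast
  then have "(\<forall>u\<in>U \<inter> {p<..<q}. \<forall>v\<in>V \<inter> {p<..<q}. u < v) \<or>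
     (\<forall>u\<in>U \<inter> {p<..<q}. \<forall>v\<in>V \<inter> {p<..<q}. v < u)"
    by (metis (no_types, lifting) greaterThanLessThan_iff order.strict_trans subset_iff)
  then show ?thesis using that p(1) q(1) meet by blast
qed

lemma open_vimage_Pair: "open U \<Longrightarrow> open {y. (x, y) \<in> U}"
  for U :: "('a::topological_space \<times> 'b::topological_space) set"
  using open_vimage[of U "Pair x"] by (simp add: vimage_def continuous_on_Pair)

section \<open>Rational subspaces of the plane as partial additive functions\<close>

lemma rat_span_insert_Pair:
  fixes S :: "(real \<times> real) set"
  shows "p \<in> rat_span (insert (x, y) S) \<longleftrightarrow>
    (\<exists>q z w. (z, w) \<in> rat_span S \<and> p = (of_rat q * x + z, of_rat q * y + w))"
proof -
  obtain a b where p: "p = (a, b)" by fastforce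
  have "p \<in> rat_span (insert (x, y) S) \<longleftrightarrow> (\<exists>q. (a - of_rat q * x, b - of_rat q * y) \<in> rat_span S)"
    by (simp add: rat_vec.span_insert p)
  also have "\<dots> \<longleftrightarrow> (\<exists>q z w. (z, w) \<in> rat_span S \<and> p = (of_rat q * x + z, of_rat q * y + w))"
    unfolding p by (metis (no_types, opaque_lifting) Pair_inject add.commute add_diff_cancel_left' diff_add_cancel)
  finally show ?thesis .
qed

text \<open>All that the recursion has to know about the barrier: countable sections, and promised
  values at \<open>D\<close> that lie above \<open>K\<close> just to the left and below
  \<open>K\<close> just to the right. Promised sets have size continuum, so fewer than continuum
  many forbidden values can always be dodged.\<close>

locale promise =
  fixes K :: "(real \<times> real) set" and D T :: "real set" and prom :: "real \<Rightarrow> real set"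
  assumes small_meager: "\<And>\<F> :: real set set.
      \<F> \<prec> (UNIV :: real set) \<Longrightarrow> (\<And>A. A \<in> \<F> \<Longrightarrow> meager A) \<Longrightarrow> meager (\<Union>\<F>)"
    and zero_K: "(0, 0) \<notin> K"
    and K_section: "\<And>x. countable {y. (x, y) \<in> K}"
    and gap: "\<And>d y. d \<in> D \<Longrightarrow> y \<in> prom d \<Longrightarrow>
      \<exists>\<epsilon>>0. (\<forall>x k. d - \<epsilon> < x \<longrightarrow> x < d \<longrightarrow> (x, k) \<in> K \<longrightarrow> k < y) \<and>
             (\<forall>x k. d < x \<longrightarrow> x < d + \<epsilon> \<longrightarrow> (x, k) \<in> K \<longrightarrow> y < k)"
    and dense: "\<And>W. open W \<Longrightarrow> W \<inter> fst ` K \<noteq> {} \<Longrightarrow> W \<inter> D \<noteq> {}"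
    and D_T: "D \<subseteq> T" and indep: "\<not> rat_dependent T" and T_meager: "meager (rat_span T)"
    and prom_large: "\<And>t. t \<in> T \<Longrightarrow> (UNIV :: real set) \<lesssim> prom t"
begin

lemma small_meager_UN:
  assumes "I \<prec> (UNIV :: real set)" "\<And>i. i \<in> I \<Longrightarrow> meager (A i :: real set)"
  shows "meager (\<Union>i\<in>I. A i)"
  by (rule small_meager) (use assms image_lesspoll in auto)

definition dom :: "(real \<times> real) set \<Rightarrow> real set" where
  "dom S = fst ` rat_span S"

lemma mem_dom: "x \<in> dom S \<longleftrightarrow> (\<exists>y. (x, y) \<in> rat_span S)"
  unfolding dom_def by force

text \<open>The last condition says that the elements of \<open>T\<close> outside the domain stay independent over it,
  so that their promised values can still be chosen freely.\<close>

definition adm :: "(real \<times> real) set \<Rightarrow> bool" where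
  "adm S \<longleftrightarrow> (\<forall>y. (0, y) \<in> rat_span S \<longrightarrow> y = 0) \<and> rat_span S \<inter> K = {} \<and>
     (\<forall>t y. (t, y) \<in> rat_span S \<longrightarrow> t \<in> T \<longrightarrow> y \<in> prom t) \<and>
     rat_span T \<inter> dom S \<subseteq> rat_span (T \<inter> dom S)"

text \<open>The pairs with \<open>q \<noteq> 0\<close> are exactly those by which the new generator
  \<open>(x, y)\<close> can enlarge the graph, so a good value creates no new point on
  \<open>K\<close>.\<close>

definition good :: "(real \<times> real) set \<Rightarrow> real \<Rightarrow> real \<Rightarrow> bool" where
  "good S x y \<longleftrightarrow> (\<forall>q z w. q \<noteq> 0 \<longrightarrow> (z, w) \<in> rat_span S \<longrightarrow>
     (of_rat q * x + z, of_rat q * y + w) \<notin> K)"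

text \<open>If \<open>of_rat q * x + z\<close> with \<open>q \<noteq> 0\<close> and \<open>z\<close>
  in the domain lies in \<open>rat_span T\<close>, then \<open>x\<close> lies here. Any other
  \<open>x\<close> joins the domain without adding elements of \<open>rat_span T\<close>.\<close>

definition blocked :: "(real \<times> real) set \<Rightarrow> real set" where
  "blocked S = {a + b | a b. a \<in> dom S \<and> b \<in> rat_span T}"

lemma subspace_dom: "rat_vec.subspace (dom S)"
proof (rule rat_vec.subspaceI)
  show "0 \<in> dom S"
    unfolding dom_def using rat_vec.span_zero[of S] by (metis fst_zero image_eqI)
  show "x + y \<in> dom S" if xy: "x \<in> dom S" "y \<in> dom S" for x y
  proof -
    obtain a b where "(x, a) \<in> rat_span S" "(y, b) \<in> rat_span S" using xy unfolding mem_dom by auto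
    then have "(x, a) + (y, b) \<in> rat_span S" by (rule rat_vec.span_add)
    then show ?thesis unfolding mem_dom by auto
  qed
  show "rat_scale c x \<in> dom S" if x: "x \<in> dom S" for c x
  proof -
    obtain y where "(x, y) \<in> rat_span S" using x unfolding mem_dom by auto
    then have "rat_scale c (x, y) \<in> rat_span S" by (rule rat_vec.span_scale)
    then show ?thesis unfolding mem_dom rat_scale_Pair by blast
  qed
qed

lemma dom_mono: "S \<subseteq> S' \<Longrightarrow> dom S \<subseteq> dom S'"
  unfolding dom_def using rat_vec.span_mono by blast

lemma domI: "(x, y) \<in> rat_span S \<Longrightarrow> x \<in> dom S"
  unfolding dom_def by force

lemma dom_subset_blocked: "dom S \<subseteq> blocked S"
  unfolding blocked_def using rat_vec.span_zero by force

text \<open>An unblocked \<open>x\<close> touches no promise. If \<open>x\<close> is in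
  \<open>T\<close>, a second new member \<open>t\<close> of \<open>T\<close> would be a combination
  of \<open>x\<close> and an element of \<open>dom S\<close>; by the last condition of
  \<open>adm\<close> that element is generated by \<open>T \<inter> dom S\<close>, and
  \<open>x\<close> would depend on the rest of \<open>T\<close>.\<close>

lemma adm_insert:
  assumes S: "adm S" and x: "x \<notin> dom S" and good: "good S x y"
    and new: "x \<in> T \<and> y \<in> prom x \<or> x \<notin> blocked S"
  shows "adm (insert (x, y) S)"
proof -
  let ?S = "insert (x, y) S"
  note dom_add = rat_vec.subspace_add[OF subspace_dom] and dom_scale = rat_vec.subspace_scale[OF subspace_dom]
    and dom_diff = rat_vec.subspace_diff[OF subspace_dom]
  have solve: "x = rat_scale (1 / q) (a - z)" if "q \<noteq> 0" "a = of_rat q * x + z" for q a z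
    using that by (simp add: of_rat_divide)
  have S1: "\<And>y. (0, y) \<in> rat_span S \<Longrightarrow> y = 0" and S2: "rat_span S \<inter> K = {}"
    and S3: "\<And>t y. (t, y) \<in> rat_span S \<Longrightarrow> t \<in> T \<Longrightarrow> y \<in> prom t"
    and S4: "rat_span T \<inter> dom S \<subseteq> rat_span (T \<inter> dom S)"
    using S unfolding adm_def by auto
  have not_blocked: "x \<in> T \<and> y \<in> prom x" if "q \<noteq> 0" "a = of_rat q * x + z" "a \<in> rat_span T" "z \<in> dom S" for q a z
  proof -
    have "x = rat_scale (- 1 / q) z + rat_scale (1 / q) a"
      using that by (simp add: of_rat_divide of_rat_minus field_simps)
    moreover have "rat_scale (- 1 / q) z \<in> dom S" using dom_scale that by blast
    moreover have "rat_scale (1 / q) a \<in> rat_span T" using rat_vec.span_scale that by blast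
    ultimately have "x \<in> blocked S" unfolding blocked_def by blast
    then show ?thesis using new by blast
  qed
  have "b = 0" if b: "(0, b) \<in> rat_span ?S" for b
  proof -
    obtain q z w where zw: "(z, w) \<in> rat_span S" "0 = of_rat q * x + z" "b = of_rat q * y + w"
      using b unfolding rat_span_insert_Pair by auto
    have "q = 0"
    proof (rule ccontr)
      assume "q \<noteq> 0"
      have "rat_scale (1 / q) (0 - z) \<in> dom S"
        using domI[OF zw(1)] by (intro dom_scale dom_diff rat_vec.subspace_0[OF subspace_dom])
      then show False using solve[OF \<open>q \<noteq> 0\<close> zw(2)] x by metis
    qed
    then show ?thesis using zw S1 by simp
  qed
  moreover have "p \<notin> K" if p: "p \<in> rat_span ?S" for p
  proof -
    obtain q z w where zw: "(z, w) \<in> rat_span S" "p = (of_rat q * x + z, of_rat q * y + w)"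
      using p unfolding rat_span_insert_Pair by blast
    show ?thesis
    proof (cases "q = 0")
      case True
      then show ?thesis using zw S2 by auto
    next
      case False
      then show ?thesis using zw good unfolding good_def by blast
    qed
  qed
  moreover have "b \<in> prom t" if tb: "(t, b) \<in> rat_span ?S" and t: "t \<in> T" for t b
  proof -
    obtain q z w where zw: "(z, w) \<in> rat_span S" "t = of_rat q * x + z" "b = of_rat q * y + w"
      using tb unfolding rat_span_insert_Pair by auto
    show ?thesis
    proof (cases "q = 0")
      case True
      then show ?thesis using zw S3 t by auto
    next
      case False
      have xT: "x \<in> T" "y \<in> prom x"
        using not_blocked[OF False zw(2) rat_vec.span_base[OF t] domI[OF zw(1)]] by auto
      have "t = x"
      proof (rule ccontr)
        assume "t \<noteq> x"
        have "t - rat_scale q x \<in> rat_span T" using xT t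
          by (intro rat_vec.span_diff rat_vec.span_scale rat_vec.span_base)
        then have "z \<in> rat_span T" using zw(2) by simp
        then have "z \<in> rat_span (T \<inter> dom S)" using S4 domI[OF zw(1)] by blast
        moreover have "T \<inter> dom S \<subseteq> T - {x}" using x by blast
        ultimately have "z \<in> rat_span (T - {x})" using rat_vec.span_mono by blast
        moreover have "t \<in> rat_span (T - {x})" using t \<open>t \<noteq> x\<close> by (intro rat_vec.span_base) auto
        ultimately have "rat_scale (1 / q) (t - z) \<in> rat_span (T - {x})"
          by (intro rat_vec.span_scale rat_vec.span_diff)
        then have "x \<in> rat_span (T - {x})" using solve[OF False zw(2)] by metis
        then show False using indep xT(1) unfolding rat_vec.dependent_def by blast
      qed
      \<comment> \<open>Otherwise \<open>z\<close> would be a nonzero rational multiple of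
        \<open>x\<close>, which lies outside the domain.\<close>
      have "q = 1"
      proof (rule ccontr)
        assume "q \<noteq> 1"
        have "z = of_rat (1 - q) * x" using zw(2) \<open>t = x\<close> by (simp add: of_rat_diff algebra_simps)
        then have "x = rat_scale (1 / (1 - q)) z" using \<open>q \<noteq> 1\<close> by (simp add: of_rat_divide)
        then show False using dom_scale[OF domI[OF zw(1)]] x by metis
      qed
      then have "z = 0" using zw(2) \<open>t = x\<close> by simp
      then have "w = 0" using zw(1) S1 by simp
      then show ?thesis using zw(3) \<open>q = 1\<close> \<open>t = x\<close> xT by simp
    qed
  qed
  moreover have "a \<in> rat_span (T \<inter> dom ?S)" if aT: "a \<in> rat_span T" and a: "a \<in> dom ?S" for a
  proof -
    have sub: "rat_span (T \<inter> dom S) \<subseteq> rat_span (T \<inter> dom ?S)"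
      using dom_mono[of S ?S] by (intro rat_vec.span_mono) auto
    obtain b where "(a, b) \<in> rat_span ?S" using a unfolding mem_dom by auto
    then obtain q z w where zw: "(z, w) \<in> rat_span S" "a = of_rat q * x + z" "b = of_rat q * y + w"
      unfolding rat_span_insert_Pair by auto
    show ?thesis
    proof (cases "q = 0")
      case True
      then show ?thesis using zw S4 aT domI[OF zw(1)] sub by auto
    next
      case False
      then have xT: "x \<in> T" using not_blocked zw aT domI by blast
      have "a - rat_scale q x \<in> rat_span T"
        by (rule rat_vec.span_diff[OF aT rat_vec.span_scale[OF rat_vec.span_base[OF xT]]])
      then have "z \<in> rat_span (T \<inter> dom ?S)" using S4 zw(2) domI[OF zw(1)] sub by auto
      moreover have "x \<in> T \<inter> dom ?S"
        using xT domI[OF rat_vec.span_base[of "(x, y)" ?S]] by auto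
      ultimately have "rat_scale q x + z \<in> rat_span (T \<inter> dom ?S)"
        by (metis rat_vec.span_add rat_vec.span_scale rat_vec.span_base)
      then show ?thesis using zw(2) by simp
    qed
  qed
  ultimately show ?thesis unfolding adm_def by blast
qed

lemma adm_empty: "adm {}"
proof -
  have "0 \<notin> T" using indep rat_vec.dependent_zero by blast
  then show ?thesis
    unfolding adm_def dom_def using zero_K by (auto simp: rat_vec.span_zero zero_prod_def)
qed

lemma adm_chain:
  assumes ne: "\<C> \<noteq> {}" and adm: "\<And>S. S \<in> \<C> \<Longrightarrow> adm S"
    and chain: "\<And>A B. A \<in> \<C> \<Longrightarrow> B \<in> \<C> \<Longrightarrow> A \<subseteq> B \<or> B \<subseteq> A"
  shows "adm (\<Union>\<C>)"
proof -
  have span: "rat_span (\<Union>\<C>) = (\<Union>S\<in>\<C>. rat_span S)"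
    using ne chain by (rule span_chain_Union)
  have dom: "dom (\<Union>\<C>) = (\<Union>S\<in>\<C>. dom S)"
    unfolding dom_def span by blast
  have "a \<in> rat_span (T \<inter> dom (\<Union>\<C>))" if a: "a \<in> rat_span T" "a \<in> dom (\<Union>\<C>)" for a
  proof -
    obtain S where S: "S \<in> \<C>" "a \<in> dom S" using a(2) dom by blast
    then have "a \<in> rat_span (T \<inter> dom S)" using adm[OF S(1)] a(1) unfolding adm_def by blast
    moreover have "T \<inter> dom S \<subseteq> T \<inter> dom (\<Union>\<C>)" using S(1) dom by blast
    ultimately show ?thesis using rat_vec.span_mono by blast
  qed
  then show ?thesis
    using adm unfolding adm_def span by blast
qed

text \<open>Each choice of \<open>q\<close> and of a point of the span excludes only countably many
  values, because the sections of \<open>K\<close> are countable.\<close>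

lemma not_good_small:
  assumes "S \<prec> (UNIV :: real set)"
  shows "{y. \<not> good S x y} \<prec> (UNIV :: real set)"
proof -
  define A where "A = (\<lambda>(q, z, w). {y. q \<noteq> 0 \<and> (of_rat q * x + z, of_rat q * y + w) \<in> K})"
  have "countable (A (q, z, w))" for q z w
  proof (cases "q = 0")
    case True
    then show ?thesis by (simp add: A_def)
  next
    case False
    have "A (q, z, w) \<subseteq> (\<lambda>k. (k - w) / of_rat q) ` {k. (of_rat q * x + z, k) \<in> K}"
    proof
      fix y assume "y \<in> A (q, z, w)"
      then have "of_rat q * y + w \<in> {k. (of_rat q * x + z, k) \<in> K}" by (simp add: A_def)
      moreover have "y = (of_rat q * y + w - w) / of_rat q" using False by simp
      ultimately show "y \<in> (\<lambda>k. (k - w) / of_rat q) ` {k. (of_rat q * x + z, k) \<in> K}" by blast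
    qed
    then show ?thesis by (rule countable_subset[OF _ countable_image[OF K_section]])
  qed
  then have "countable (A i)" for i by (cases i) auto
  then have "(\<Union>i\<in>UNIV \<times> rat_span S. A i) \<prec> (UNIV :: real set)"
    by (intro UN_countable_lesspoll_real countable_Times_lesspoll_real span_lesspoll_real assms) auto
  moreover have "{y. \<not> good S x y} \<subseteq> (\<Union>i\<in>UNIV \<times> rat_span S. A i)"
    unfolding good_def A_def by force
  ultimately show ?thesis using lesspoll_trans1 subset_imp_lepoll by blast
qed

lemma good_exists:
  assumes "S \<prec> (UNIV :: real set)" "(UNIV :: real set) \<lesssim> Y"
  obtains y where "y \<in> Y" "good S x y"
proof -
  have "\<not> Y \<subseteq> {y. \<not> good S x y}"
    using not_good_small[OF assms(1), of x] assms(2)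
    by (meson lepoll_trans not_lepoll_iff_lesspoll subset_imp_lepoll)
  then show ?thesis using that by blast
qed

lemma blocked_meager:
  assumes "S \<prec> (UNIV :: real set)"
  shows "meager (blocked S)"
proof -
  have "dom S \<prec> (UNIV :: real set)"
    unfolding dom_def by (intro image_lesspoll span_lesspoll_real assms)
  then have "meager (\<Union>a\<in>dom S. (\<lambda>x. a + x) ` rat_span T)"
    by (intro small_meager_UN meager_translation T_meager)
  moreover have "blocked S = (\<Union>a\<in>dom S. (\<lambda>x. a + x) ` rat_span T)"
    unfolding blocked_def by blast
  ultimately show ?thesis by simp
qed

lemma extend_T:
  assumes "adm S" "S \<prec> (UNIV :: real set)" "t \<in> T"
  shows "\<exists>F. finite F \<and> adm (S \<union> F) \<and> t \<in> dom (S \<union> F)"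
proof (cases "t \<in> dom S")
  case True
  then show ?thesis using assms by (intro exI[of _ "{}"]) auto
next
  case False
  obtain y where y: "y \<in> prom t" "good S t y"
    using good_exists[OF assms(2) prom_large[OF assms(3)]] by blast
  then have "adm (insert (t, y) S)"
    using adm_insert False assms by blast
  moreover have "t \<in> dom (insert (t, y) S)"
    by (rule domI[OF rat_vec.span_base]) auto
  ultimately show ?thesis by (intro exI[of _ "{(t, y)}"]) auto
qed

lemma union_finite_small:
  assumes "S \<prec> (UNIV :: real set)" "finite F"
  shows "S \<union> F \<prec> (UNIV :: real set)"
  by (rule Un_lesspoll_real[OF assms(1) countable_lesspoll_real[OF countable_finite[OF assms(2)]]])

lemma extend_finite_T:
  assumes "finite A" "adm S" "S \<prec> (UNIV :: real set)" "A \<subseteq> T"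
  shows "\<exists>F. finite F \<and> adm (S \<union> F) \<and> A \<subseteq> dom (S \<union> F)"
  using assms(1,4)
proof induction
  case empty
  then show ?case using assms by (intro exI[of _ "{}"]) auto
next
  case (insert t A)
  then obtain F where F: "finite F" "adm (S \<union> F)" "A \<subseteq> dom (S \<union> F)" by auto
  obtain F' where F': "finite F'" "adm (S \<union> F \<union> F')" "t \<in> dom (S \<union> F \<union> F')"
    using extend_T[OF F(2) union_finite_small[OF assms(3) F(1)]] insert by blast
  have "A \<subseteq> dom (S \<union> F \<union> F')" using F(3) dom_mono[of "S \<union> F" "S \<union> F \<union> F'"] by blast
  then show ?case using F F' by (intro exI[of _ "F \<union> F'"]) (auto simp: Un_assoc)
qed

text \<open>An unblocked point takes any good value. A blocked one is a domain element plus a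
  combination of finitely many members of \<open>T\<close>; once these have their promised values,
  additivity determines the rest.\<close>

lemma extend_dom:
  assumes "adm S" "S \<prec> (UNIV :: real set)"
  shows "\<exists>F. finite F \<and> adm (S \<union> F) \<and> x \<in> dom (S \<union> F)"
proof (cases "x \<in> blocked S")
  case True
  then obtain a b where ab: "a \<in> dom S" "b \<in> rat_span T" "x = a + b"
    unfolding blocked_def by blast
  then obtain A where A: "finite A" "A \<subseteq> T" "b \<in> rat_span A"
    unfolding rat_vec.span_explicit by blast
  obtain F where F: "finite F" "adm (S \<union> F)" "A \<subseteq> dom (S \<union> F)"
    using extend_finite_T[OF A(1) assms A(2)] by blast
  have "b \<in> dom (S \<union> F)" using A(3) F(3) rat_vec.span_minimal subspace_dom by blast
  moreover have "a \<in> dom (S \<union> F)" using ab(1) dom_mono[of S "S \<union> F"] by blast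
  ultimately show ?thesis using F ab(3) rat_vec.subspace_add[OF subspace_dom] by blast
next
  case False
  then have "x \<notin> dom S" using dom_subset_blocked by blast
  moreover obtain y where y: "good S x y"
    using good_exists[OF assms(2) lepoll_refl] by blast
  ultimately have "adm (insert (x, y) S)" using adm_insert False assms by blast
  moreover have "x \<in> dom (insert (x, y) S)"
    by (rule domI[OF rat_vec.span_base]) auto
  ultimately show ?thesis by (intro exI[of _ "{(x, y)}"]) auto
qed

end

section \<open>Hitting the boundary\<close>

context promise
begin

text \<open>The upper boundary \<open>s\<close> of \<open>U\<close> avoids \<open>U \<union> V\<close>. If none of its points can be put on the
  graph, then over some interval it follows an affine copy of \<open>K\<close>, and then the copies of the gaps
  of \<open>K\<close> also avoid \<open>U \<union> V\<close>.\<close>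

lemma follow_barrier:
  assumes S: "S \<prec> (UNIV :: real set)"
    and o: "open U" "open V" and J: "open J" "J \<noteq> {}"
    and order: "\<And>x u v. x \<in> J \<Longrightarrow> (x, u) \<in> U \<Longrightarrow> (x, v) \<in> V \<Longrightarrow> u \<in> {p<..<q} \<Longrightarrow> v \<in> {p<..<q} \<Longrightarrow> u < v"
    and U_ne: "\<And>x. x \<in> J \<Longrightarrow> \<exists>u\<in>{p<..<q}. (x, u) \<in> U"
    and V_ne: "\<And>x. x \<in> J \<Longrightarrow> \<exists>v\<in>{p<..<q}. (x, v) \<in> V"
    and not_good: "\<And>x y. x \<in> J - blocked S \<Longrightarrow> (x, y) \<notin> U \<union> V \<Longrightarrow> \<not> good S x y"
  obtains c z w J' x0 where "c \<noteq> 0" "(z, w) \<in> rat_span S" "open J'" "J' \<subseteq> J" "x0 \<in> J'"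
    "of_rat c * x0 + z \<in> fst ` K"
    "\<And>x y. x \<in> J' \<Longrightarrow> of_rat c * x + z \<in> D \<Longrightarrow> y \<in> prom (of_rat c * x + z) \<Longrightarrow>
      (x, (y - w) / of_rat c) \<notin> U \<union> V"
proof -
  define s where "s x = Sup {u \<in> {p<..<q}. (x, u) \<in> U}" for x
  have bdd: "bdd_above {u \<in> {p<..<q}. (x, u) \<in> U}" for x
    by (rule bdd_above_mono[of "{p<..<q}"]) auto
  have s_upper: "u \<le> s x" if "u \<in> {p<..<q}" "(x, u) \<in> U" for x u
    unfolding s_def using that by (intro cSup_upper bdd) auto
  have s_least: "s x \<le> v" if "x \<in> J" "v \<in> {p<..<q}" "(x, v) \<in> V" for x v
    unfolding s_def
  proof (rule cSup_least)
    show "{u \<in> {p<..<q}. (x, u) \<in> U} \<noteq> {}" using U_ne[OF that(1)] by blast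
    show "u \<le> v" if "u \<in> {u \<in> {p<..<q}. (x, u) \<in> U}" for u
      using order[OF \<open>x \<in> J\<close> _ \<open>(x, v) \<in> V\<close> _ \<open>v \<in> {p<..<q}\<close>] that by (simp add: less_imp_le)
  qed
  have s_pq: "p < s x" "s x < q" if "x \<in> J" for x
  proof -
    obtain u v where "u \<in> {p<..<q}" "(x, u) \<in> U" "v \<in> {p<..<q}" "(x, v) \<in> V"
      using U_ne[OF \<open>x \<in> J\<close>] V_ne[OF \<open>x \<in> J\<close>] by blast
    then show "p < s x" "s x < q" using s_upper[of u x] s_least[OF \<open>x \<in> J\<close>, of v] by auto
  qed
  have s_notin: "(x, s x) \<notin> U \<union> V" if x: "x \<in> J" for x
  proof
    assume "(x, s x) \<in> U \<union> V"
    then consider "(x, s x) \<in> U" | "(x, s x) \<in> V" by blast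
    then show False
    proof cases
      case 1
      have "open ({u. (x, u) \<in> U} \<inter> {..<q})" by (intro open_Int open_vimage_Pair o) auto
      then obtain e where e: "e > 0" "ball (s x) e \<subseteq> {u. (x, u) \<in> U} \<inter> {..<q}"
        using 1 s_pq(2)[OF x] open_contains_ball by (metis Int_iff lessThan_iff mem_Collect_eq)
      have "s x + e / 2 \<in> ball (s x) e" using e(1) by (simp add: dist_real_def)
      then have "s x + e / 2 \<in> {u. (x, u) \<in> U} \<inter> {..<q}" using e(2) by blast
      then have "(x, s x + e / 2) \<in> U" "s x + e / 2 < q" by auto
      then show False using s_upper[of "s x + e / 2" x] s_pq(1)[OF x] e(1) by simp
    next
      case 2
      have "open ({u. (x, u) \<in> V} \<inter> {p<..})" by (intro open_Int open_vimage_Pair o) auto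
      then obtain e where e: "e > 0" "ball (s x) e \<subseteq> {u. (x, u) \<in> V} \<inter> {p<..}"
        using 2 s_pq(1)[OF x] open_contains_ball by (metis Int_iff greaterThan_iff mem_Collect_eq)
      have "s x - e / 2 \<in> ball (s x) e" using e(1) by (simp add: dist_real_def)
      then have "s x - e / 2 \<in> {u. (x, u) \<in> V} \<inter> {p<..}" using e(2) by blast
      then have "(x, s x - e / 2) \<in> V" "p < s x - e / 2" by auto
      then show False using s_least[OF x, of "s x - e / 2"] s_pq(2)[OF x] e(1) by simp
    qed
  qed
  \<comment> \<open>The points over which the boundary lies on the affine copy of \<open>K\<close>
    given by \<open>(c, z, w)\<close>.\<close>
  define A where "A = (\<lambda>(c, z, w). {x \<in> J. c \<noteq> 0 \<and> (of_rat c * x + z, of_rat c * s x + w) \<in> K})"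
  let ?I = "(UNIV :: rat set) \<times> rat_span S"
  have cover: "J \<subseteq> blocked S \<union> (\<Union>i\<in>?I. A i)"
  proof
    fix x assume x: "x \<in> J"
    show "x \<in> blocked S \<union> (\<Union>i\<in>?I. A i)"
    proof (cases "x \<in> blocked S")
      case False
      then have "\<not> good S x (s x)" using not_good[of x "s x"] s_notin[OF x] x by blast
      then obtain c z w where "c \<noteq> 0" "(z, w) \<in> rat_span S" "(of_rat c * x + z, of_rat c * s x + w) \<in> K"
        unfolding good_def by blast
      then have "x \<in> A (c, z, w)" "(c, z, w) \<in> ?I" using x by (auto simp: A_def)
      then show ?thesis by blast
    qed simp
  qed
  have "?I \<prec> (UNIV :: real set)"
    by (intro countable_Times_lesspoll_real span_lesspoll_real S) auto
  \<comment> \<open>Here the category hypothesis is essential: there are fewer than continuum many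
    copies, but possibly uncountably many.\<close>
  then have *: "(\<And>i. i \<in> ?I \<Longrightarrow> nowhere_dense (A i)) \<Longrightarrow> meager (\<Union>i\<in>?I. A i)"
    by (intro small_meager_UN nowhere_dense_imp_meager)
  have sub: "A i \<subseteq> J" for i by (cases i) (auto simp: A_def)
  obtain i J' where i: "i \<in> ?I" and J': "open J'" "J' \<noteq> {}" "J' \<subseteq> J" "J' \<subseteq> closure (A i)"
    by (rule dense_member_of_cover[OF J blocked_meager[OF S] cover * sub])
  obtain c z w where czw: "i = (c, z, w)" "(z, w) \<in> rat_span S" using i by (cases i) auto
  have meets: "W \<inter> A i \<noteq> {}" if "open W" "W \<noteq> {}" "W \<subseteq> J'" for W
    using that J'(4) open_Int_closure_eq_empty[of W "A i"] by blast
  obtain x0 where x0: "x0 \<in> J'" "x0 \<in> A i" using meets[OF J'(1,2)] by blast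
  then have c0: "c \<noteq> 0" and "of_rat c * x0 + z \<in> fst ` K"
    unfolding czw A_def by (auto intro: rev_image_eqI)
  moreover have "(x, (y - w) / of_rat c) \<notin> U \<union> V"
    if x: "x \<in> J'" and d: "of_rat c * x + z \<in> D" and y: "y \<in> prom (of_rat c * x + z)" for x y
  proof -
    define y' where "y' = (y - w) / of_rat c"
    have y_eq: "y = of_rat c * y' + w" using c0 by (simp add: y'_def)
    obtain \<epsilon> where \<epsilon>: "\<epsilon> > 0"
      and left: "\<And>a k. of_rat c * x + z - \<epsilon> < a \<Longrightarrow> a < of_rat c * x + z \<Longrightarrow> (a, k) \<in> K \<Longrightarrow> k < y"
      and right: "\<And>a k. of_rat c * x + z < a \<Longrightarrow> a < of_rat c * x + z + \<epsilon> \<Longrightarrow> (a, k) \<in> K \<Longrightarrow> y < k"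
      using gap[OF d y] by blast
    obtain e where e: "e > 0" "ball x e \<subseteq> J'" using J'(1) x open_contains_ball by blast
    have near: "(\<exists>a\<in>J. \<bar>a - x\<bar> < \<delta> \<and> s a < y') \<and> (\<exists>a\<in>J. \<bar>a - x\<bar> < \<delta> \<and> y' < s a)"
      if \<delta>: "\<delta> > 0" for \<delta>
    proof -
      \<comment> \<open>Small enough to stay within \<open>\<delta>\<close>, within
        \<open>J'\<close>, and, after scaling by \<open>c\<close>, within the range
        \<open>\<epsilon>\<close> of the gap.\<close>
      define \<eta> where "\<eta> = min \<delta> (min e (\<epsilon> / \<bar>of_rat c\<bar>))"
      have \<eta>: "\<eta> > 0" "\<eta> \<le> \<delta>" "\<eta> \<le> e" "\<eta> \<le> \<epsilon> / \<bar>of_rat c\<bar>"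
        using \<delta> e(1) \<epsilon> c0 by (auto simp: \<eta>_def)
      have "{x - \<eta><..<x} \<subseteq> J'" "{x<..<x + \<eta>} \<subseteq> J'"
        using e(2) \<eta>(3) by (auto simp: dist_real_def subset_iff)
      then have "{x - \<eta><..<x} \<inter> A i \<noteq> {}" "{x<..<x + \<eta>} \<inter> A i \<noteq> {}"
        using \<eta>(1) by (intro meets; simp)+
      then obtain a b where a: "a \<in> {x - \<eta><..<x}" "a \<in> A i" and b: "b \<in> {x<..<x + \<eta>}" "b \<in> A i"
        by blast
      have Ka: "(of_rat c * a + z, of_rat c * s a + w) \<in> K" and Kb: "(of_rat c * b + z, of_rat c * s b + w) \<in> K"
        using a(2) b(2) by (auto simp: czw A_def)
      have small: "\<bar>of_rat c * t - of_rat c * x\<bar> < \<epsilon>" if "\<bar>t - x\<bar> < \<eta>" for t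
      proof -
        have "0 < \<bar>of_rat c :: real\<bar>" using c0 by simp
        moreover have "\<bar>t - x\<bar> < \<epsilon> / \<bar>of_rat c\<bar>" using that \<eta>(4) by linarith
        ultimately have "\<bar>of_rat c\<bar> * \<bar>t - x\<bar> < \<epsilon>"
          by (metis pos_less_divide_eq mult.commute)
        then show ?thesis by (simp add: abs_mult flip: right_diff_distrib)
      qed
      have sm: "\<bar>of_rat c * a - of_rat c * x\<bar> < \<epsilon>" "\<bar>of_rat c * b - of_rat c * x\<bar> < \<epsilon>"
        using a(1) b(1) small[of a] small[of b] by auto
      \<comment> \<open>A negative \<open>c\<close> reflects both coordinates, so the boundary is
        below \<open>y'\<close> on the left and above it on the right for either sign.\<close>
      have "s a < y' \<and> y' < s b"
      proof (cases "c > 0")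
        case True
        then have "of_rat c * a < of_rat c * x" "of_rat c * x < of_rat c * b"
          using a(1) b(1) by (auto simp: mult_less_cancel_left_pos)
        then have "of_rat c * s a + w < y" "y < of_rat c * s b + w"
          using left[OF _ _ Ka] right[OF _ _ Kb] sm by auto
        then show ?thesis using True unfolding y_eq by (simp add: mult_less_cancel_left_pos)
      next
        case False
        then have neg: "(of_rat c :: real) < 0" using c0 by simp
        then have "of_rat c * x < of_rat c * a" "of_rat c * b < of_rat c * x"
          using a(1) b(1) by (auto simp: mult_less_cancel_left_neg)
        then have "y < of_rat c * s a + w" "of_rat c * s b + w < y"
          using right[OF _ _ Ka] left[OF _ _ Kb] sm by auto
        then show ?thesis using neg unfolding y_eq by (simp add: mult_less_cancel_left_neg)
      qed
      moreover have "a \<in> J" "b \<in> J" using a(2) b(2) sub[of i] by blast+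
      moreover have "\<bar>a - x\<bar> < \<delta>" "\<bar>b - x\<bar> < \<delta>" using a(1) b(1) \<eta>(2) by auto
      ultimately show ?thesis by blast
    qed
    have "p < y'" "y' < q"
      using near[of 1] s_pq by (force intro: less_trans)+
    have nbhd: "\<exists>\<delta>>0. \<forall>a. \<bar>a - x\<bar> < \<delta> \<longrightarrow> (a, y') \<in> G" if G: "open G" "(x, y') \<in> G" for G :: "(real \<times> real) set"
    proof -
      have "open {a. (a, y') \<in> G}"
        using open_vimage[OF G(1), of "\<lambda>a. (a, y')"] by (simp add: vimage_def continuous_on_Pair)
      then obtain \<delta> where "\<delta> > 0" "ball x \<delta> \<subseteq> {a. (a, y') \<in> G}"
        using G(2) open_contains_ball by blast
      then show ?thesis by (intro exI[of _ \<delta>]) (auto simp: dist_real_def subset_iff abs_minus_commute)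
    qed
    \<comment> \<open>Membership would persist at the same height over nearby points, including one
      whose upper boundary is lower.\<close>
    have "(x, y') \<notin> U"
    proof
      assume "(x, y') \<in> U"
      then obtain \<delta> where \<delta>: "\<delta> > 0" "\<And>a. \<bar>a - x\<bar> < \<delta> \<Longrightarrow> (a, y') \<in> U" using nbhd[OF o(1)] by blast
      then obtain a where "(a, y') \<in> U" "s a < y'" using near[OF \<delta>(1)] by blast
      then show False using s_upper[of y' a] \<open>p < y'\<close> \<open>y' < q\<close> by simp
    qed
    moreover have "(x, y') \<notin> V"
    proof
      assume "(x, y') \<in> V"
      then obtain \<delta> where \<delta>: "\<delta> > 0" "\<And>a. \<bar>a - x\<bar> < \<delta> \<Longrightarrow> (a, y') \<in> V" using nbhd[OF o(2)] by blast
      then obtain a where "a \<in> J" "(a, y') \<in> V" "y' < s a" using near[OF \<delta>(1)] by blast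
      then show False using s_least[of a y'] \<open>p < y'\<close> \<open>y' < q\<close> by simp
    qed
    ultimately show ?thesis by (simp add: y'_def)
  qed
  ultimately show ?thesis using that[OF c0 czw(2) J'(1,3) x0(1)] by blast
qed

text \<open>Since \<open>U\<close> and \<open>V\<close> are open, a pair in the wrong order would
  persist over nearby points, hence over some point of \<open>A\<close>.\<close>

lemma order_extends:
  fixes U V :: "(real \<times> real) set"
  assumes o: "open U" "open V" and disj: "U \<inter> V = {}" and J: "open J" "J \<subseteq> closure A"
    and A: "\<And>a u v. a \<in> A \<Longrightarrow> (a, u) \<in> U \<Longrightarrow> (a, v) \<in> V \<Longrightarrow> u \<in> {p<..<q} \<Longrightarrow> v \<in> {p<..<q} \<Longrightarrow> u < v"
    and x: "x \<in> J" "(x, u) \<in> U" "(x, v) \<in> V" "u \<in> {p<..<q}" "v \<in> {p<..<q}"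
  shows "u < v"
proof -
  have slice: "open {a. (a, y) \<in> G}" if "open G" for y :: real and G :: "(real \<times> real) set"
    using open_vimage[OF that, of "\<lambda>a. (a, y)"] by (simp add: vimage_def continuous_on_Pair)
  have "open ({a. (a, u) \<in> U} \<inter> {a. (a, v) \<in> V} \<inter> J)"
    by (intro open_Int slice o J(1))
  moreover have "x \<in> {a. (a, u) \<in> U} \<inter> {a. (a, v) \<in> V} \<inter> J" using x by simp
  ultimately have "({a. (a, u) \<in> U} \<inter> {a. (a, v) \<in> V} \<inter> J) \<inter> A \<noteq> {}"
    using J(2) open_Int_closure_eq_empty[of "{a. (a, u) \<in> U} \<inter> {a. (a, v) \<in> V} \<inter> J" A] by blast
  then show ?thesis using A x by blast
qed

text \<open>If no good boundary value exists over an unblocked point, then over each such point all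
  boundary values are bad, hence few. This puts \<open>isolated_switch\<close>, and then
  \<open>follow_barrier\<close>, within reach.\<close>

lemma extend_hit:
  assumes adm: "adm S" and S: "S \<prec> (UNIV :: real set)"
    and o: "open U" "open V" and disj: "U \<inter> V = {}" and X_ne: "fst ` U \<inter> fst ` V \<noteq> {}"
  shows "\<exists>F. finite F \<and> adm (S \<union> F) \<and>
    (\<exists>x y. (x, y) \<in> rat_span (S \<union> F) \<and> x \<in> fst ` U \<inter> fst ` V \<and> (x, y) \<notin> U \<union> V)"
proof -
  define X where "X = fst ` U \<inter> fst ` V"
  have X: "open X" "X \<noteq> {}" using o X_ne unfolding X_def by (auto intro: open_image_fst)
  show ?thesis
  proof (cases "\<exists>x y. x \<in> X - blocked S \<and> (x, y) \<notin> U \<union> V \<and> good S x y")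
    case True
    then obtain x y where xy: "x \<in> X - blocked S" "(x, y) \<notin> U \<union> V" "good S x y" by blast
    then have "adm (insert (x, y) S)" using adm adm_insert dom_subset_blocked by blast
    moreover have "(x, y) \<in> rat_span (insert (x, y) S)" by (intro rat_vec.span_base) auto
    ultimately show ?thesis
      using xy by (intro exI[of _ "{(x, y)}"]) (auto simp: X_def)
  next
    case False
    then have not_good: "\<And>x y. x \<in> X - blocked S \<Longrightarrow> (x, y) \<notin> U \<union> V \<Longrightarrow> \<not> good S x y" by blast
    define ordered where "ordered G H p q x \<longleftrightarrow>
      (\<forall>u v. (x, u) \<in> G \<longrightarrow> (x, v) \<in> H \<longrightarrow> u \<in> {p<..<q} \<longrightarrow> v \<in> {p<..<q} \<longrightarrow> u < v)"
      for G H :: "(real \<times> real) set" and p q x :: real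
    \<comment> \<open>The Boolean tells which of the two sets is the lower one. With
      \<open>p\<close> and \<open>q\<close> rational there are countably many triples.\<close>
    define A where "A = (\<lambda>(p, q, b). {x \<in> X - blocked S.
       (\<exists>u\<in>{p<..<q}. (x, u) \<in> U) \<and> (\<exists>v\<in>{p<..<q}. (x, v) \<in> V) \<and>
       (if b then ordered U V p q x else ordered V U p q x)})"
    let ?I = "\<rat> \<times> \<rat> \<times> (UNIV :: bool set)"
    have cover: "X \<subseteq> blocked S \<union> (\<Union>i\<in>?I. A i)"
    proof
      fix x assume x: "x \<in> X"
      show "x \<in> blocked S \<union> (\<Union>i\<in>?I. A i)"
      proof (cases "x \<in> blocked S")
        case False
        let ?U = "{u. (x, u) \<in> U}" and ?V = "{v. (x, v) \<in> V}"
        have "- (?U \<union> ?V) \<subseteq> {y. \<not> good S x y}" using not_good[of x] x False by blast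
        then have "- (?U \<union> ?V) \<prec> (UNIV :: real set)"
          using not_good_small[OF S] lesspoll_trans1 subset_imp_lepoll by blast
        moreover have "?U \<inter> ?V = {}" "?U \<noteq> {}" "?V \<noteq> {}"
          using disj x unfolding X_def by auto
        ultimately obtain p q where pq: "p \<in> \<rat>" "q \<in> \<rat>" "?U \<inter> {p<..<q} \<noteq> {}" "?V \<inter> {p<..<q} \<noteq> {}"
          "(\<forall>u\<in>?U \<inter> {p<..<q}. \<forall>v\<in>?V \<inter> {p<..<q}. u < v) \<or>
           (\<forall>u\<in>?U \<inter> {p<..<q}. \<forall>v\<in>?V \<inter> {p<..<q}. v < u)"
          using isolated_switch[OF open_vimage_Pair[OF o(1)] open_vimage_Pair[OF o(2)]] by metis
        then have "ordered U V p q x \<or> ordered V U p q x" unfolding ordered_def by blast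
        then have "x \<in> A (p, q, ordered U V p q x)"
          using x False pq(3,4) unfolding A_def by auto
        moreover have "(p, q, ordered U V p q x) \<in> ?I" using pq by simp
        ultimately show ?thesis by blast
      qed simp
    qed
    have *: "(\<And>i. i \<in> ?I \<Longrightarrow> nowhere_dense (A i)) \<Longrightarrow> meager (\<Union>i\<in>?I. A i)"
      by (intro meager_UN nowhere_dense_imp_meager countable_SIGMA countable_rat) auto
    have sub: "A i \<subseteq> X" for i by (cases i) (auto simp: A_def)
    obtain i J where J: "open J" "J \<noteq> {}" "J \<subseteq> X" "J \<subseteq> closure (A i)"
      by (rule dense_member_of_cover[OF X blocked_meager[OF S] cover * sub])
    obtain p q b where i: "i = (p, q, b)" by (cases i) auto
    define strip where "strip G = G \<inter> UNIV \<times> {p<..<q}" for G :: "(real \<times> real) set"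
    \<comment> \<open>\<open>A i\<close> is only dense in \<open>J\<close>, but that the strip meets
      both sets over \<open>x\<close> is an open condition, so it holds throughout an open
      set.\<close>
    define J1 where "J1 = J \<inter> fst ` strip U \<inter> fst ` strip V"
    have strip: "x \<in> fst ` strip G \<longleftrightarrow> (\<exists>u\<in>{p<..<q}. (x, u) \<in> G)" for x G
      unfolding strip_def by force
    have "open J1"
      unfolding J1_def strip_def using J(1) o by (intro open_Int open_image_fst open_Times) auto
    have "J \<inter> A i \<noteq> {}" using J open_Int_closure_eq_empty[of J "A i"] by blast
    then obtain x1 where "x1 \<in> J" "x1 \<in> A (p, q, b)" unfolding i by blast
    then have "x1 \<in> J1" unfolding J1_def by (simp add: strip A_def)
    then have "J1 \<noteq> {}" by blast
    have "J1 \<subseteq> J" unfolding J1_def by blast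
    have ng: "\<And>x y. x \<in> J1 - blocked S \<Longrightarrow> (x, y) \<notin> U \<union> V \<Longrightarrow> \<not> good S x y"
      using not_good \<open>J1 \<subseteq> J\<close> J(3) by blast
    have ne: "\<exists>u\<in>{p<..<q}. (x, u) \<in> U" "\<exists>v\<in>{p<..<q}. (x, v) \<in> V" if "x \<in> J1" for x
      using that unfolding J1_def Int_iff strip by blast+
    have cl: "J1 \<subseteq> closure (A i)" using \<open>J1 \<subseteq> J\<close> J(4) by blast
    obtain c z w J' x0 where c: "c \<noteq> 0" "(z, w) \<in> rat_span S" "open J'" "J' \<subseteq> J1" "x0 \<in> J'"
      "of_rat c * x0 + z \<in> fst ` K"
      "\<And>x y. x \<in> J' \<Longrightarrow> of_rat c * x + z \<in> D \<Longrightarrow> y \<in> prom (of_rat c * x + z) \<Longrightarrow>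
        (x, (y - w) / of_rat c) \<notin> U \<union> V"
    proof (cases b)
      case True
      have "u < v" if "x \<in> J1" "(x, u) \<in> U" "(x, v) \<in> V" "u \<in> {p<..<q}" "v \<in> {p<..<q}" for x u v
        by (rule order_extends[OF o disj \<open>open J1\<close> cl _ that])
           (auto simp: i A_def ordered_def True)
      then show ?thesis
        using follow_barrier[OF S o \<open>open J1\<close> \<open>J1 \<noteq> {}\<close> _ ne ng] that by blast
    next
      case False
      have lt: "u < v" if "x \<in> J1" "(x, u) \<in> V" "(x, v) \<in> U" "u \<in> {p<..<q}" "v \<in> {p<..<q}" for x u v
        by (rule order_extends[OF o(2,1) _ \<open>open J1\<close> cl _ that])
           (use disj in \<open>auto simp: i A_def ordered_def False\<close>)
      have ng': "\<And>x y. x \<in> J1 - blocked S \<Longrightarrow> (x, y) \<notin> V \<union> U \<Longrightarrow> \<not> good S x y"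
        using ng by blast
      show ?thesis
        by (rule follow_barrier[OF S o(2,1) \<open>open J1\<close> \<open>J1 \<noteq> {}\<close> lt ne(2,1) ng'])
           (use that in \<open>simp_all add: Un_commute\<close>)
    qed
    have c0: "(of_rat c :: real) \<noteq> 0" using c(1) by simp
    define W where "W = {a. (a - z) / of_rat c \<in> J'}"
    have "open W"
      unfolding W_def using open_vimage[OF c(3), of "\<lambda>a. (a - z) / of_rat c"] c0
      by (simp add: vimage_def continuous_intros)
    moreover have "of_rat c * x0 + z \<in> W \<inter> fst ` K" using c(5,6) c0 by (simp add: W_def)
    \<comment> \<open>\<open>J'\<close> meets the pulled-back projection of \<open>K\<close>, so
      density supplies a jump point whose pullback lies in \<open>J'\<close>.\<close>
    ultimately obtain d where d: "d \<in> W" "d \<in> D" using dense by blast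
    obtain F where F: "finite F" "adm (S \<union> F)" "d \<in> dom (S \<union> F)"
      using extend_T[OF adm S] d(2) D_T by blast
    obtain y where y: "(d, y) \<in> rat_span (S \<union> F)" using F(3) unfolding mem_dom by blast
    have "y \<in> prom d" using F(2) y d(2) D_T unfolding adm_def by blast
    define x where "x = (d - z) / of_rat c"
    have x: "x \<in> J'" "of_rat c * x + z = d" using d(1) c0 by (simp_all add: W_def x_def)
    have "(z, w) \<in> rat_span (S \<union> F)" using c(2) rat_vec.span_mono[of S "S \<union> F"] by blast
    \<comment> \<open>As \<open>(z, w)\<close> is already on the graph, the promised value at
      \<open>d\<close> determines the value at the pullback of \<open>d\<close>, inside the
      transported gap.\<close>
    then have "rat_scale (1 / c) ((d, y) - (z, w)) \<in> rat_span (S \<union> F)"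
      using y by (intro rat_vec.span_scale rat_vec.span_diff)
    then have "(x, (y - w) / of_rat c) \<in> rat_span (S \<union> F)"
      by (simp add: x_def of_rat_divide)
    moreover have "(x, (y - w) / of_rat c) \<notin> U \<union> V"
      using c(7)[OF x(1)] x(2) d(2) \<open>y \<in> prom d\<close> by simp
    moreover have "x \<in> X" using x(1) c(4) \<open>J1 \<subseteq> J\<close> J(3) by blast
    ultimately show ?thesis using F X_def by blast
  qed
qed

lemma exists_function:
  obtains f :: "real \<Rightarrow> real" where "Modules.additive f"
    "\<And>q x. f (of_rat q * x) = of_rat q * f x" "\<And>x. (x, f x) \<notin> K" "\<And>t. t \<in> T \<Longrightarrow> f t \<in> prom t"
    "\<And>U V. open U \<Longrightarrow> open V \<Longrightarrow> U \<inter> V = {} \<Longrightarrow> fst ` U \<inter> fst ` V \<noteq> {} \<Longrightarrow>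
      \<exists>x\<in>fst ` U \<inter> fst ` V. (x, f x) \<notin> U \<union> V"
proof -
  define I where "I = (UNIV :: real set) \<times> {U :: (real \<times> real) set. open U} \<times> {V :: (real \<times> real) set. open V}"
  define task where "task = (\<lambda>(r, U, V) S. r \<in> dom S \<and> (U \<inter> V = {} \<longrightarrow> fst ` U \<inter> fst ` V \<noteq> {} \<longrightarrow>
     (\<exists>x y. (x, y) \<in> rat_span S \<and> x \<in> fst ` U \<inter> fst ` V \<and> (x, y) \<notin> U \<union> V)))"
  have mono: "task i S'" if "task i S" "S \<subseteq> S'" for i S S'
    using that dom_mono[OF that(2)] rat_vec.span_mono[OF that(2)]
    unfolding task_def by (cases i) (simp, blast)
  have step: "\<exists>F. finite F \<and> adm (S \<union> F) \<and> task i (S \<union> F)"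
    if S: "adm S" "S \<prec> (UNIV :: real set)" and i: "i \<in> I" for S i
  proof -
    obtain r U V where i_eq: "i = (r, U, V)" and o: "open U" "open V"
      using i unfolding I_def by auto
    obtain F where F: "finite F" "adm (S \<union> F)" "r \<in> dom (S \<union> F)" using extend_dom[OF S] by blast
    show ?thesis
    proof (cases "U \<inter> V = {} \<and> fst ` U \<inter> fst ` V \<noteq> {}")
      case True
      obtain F' where F': "finite F'" "adm (S \<union> F \<union> F')"
        "\<exists>x y. (x, y) \<in> rat_span (S \<union> F \<union> F') \<and> x \<in> fst ` U \<inter> fst ` V \<and> (x, y) \<notin> U \<union> V"
        using extend_hit[OF F(2) union_finite_small[OF S(2) F(1)] o] True by blast
      have "r \<in> dom (S \<union> F \<union> F')" using F(3) dom_mono[of "S \<union> F" "S \<union> F \<union> F'"] by blast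
      then show ?thesis
        using F F' by (intro exI[of _ "F \<union> F'"]) (simp add: task_def i_eq Un_assoc)
    next
      case False
      then show ?thesis using F by (intro exI[of _ F]) (auto simp: task_def i_eq)
    qed
  qed
  have "infinite (UNIV :: real set)" by (rule infinite_UNIV_char_0)
  then have "I \<lesssim> (UNIV :: real set)"
    unfolding I_def by (intro Times_lepoll_infinite open_sets_lepoll_real lepoll_refl)
  then have "\<exists>S. adm S \<and> (\<forall>i\<in>I. task i S)"
    by (rule transfinite_construction) (fact adm_empty adm_chain step mono)+
  then obtain S where S: "adm S" "\<And>i. i \<in> I \<Longrightarrow> task i S" by blast
  \<comment> \<open>With empty sets only the domain part of the task remains.\<close>
  have total: "\<exists>y. (x, y) \<in> rat_span S" for x
    using S(2)[of "(x, {}, {})"] by (simp add: I_def task_def mem_dom)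
  have unique: "y = y'" if "(x, y) \<in> rat_span S" "(x, y') \<in> rat_span S" for x y y'
  proof -
    have "(0, y - y') \<in> rat_span S" using rat_vec.span_diff[OF that] by simp
    then have "y - y' = 0" using S(1) unfolding adm_def by blast
    then show ?thesis by simp
  qed
  define f where "f x = (THE y. (x, y) \<in> rat_span S)" for x
  have f: "(x, y) \<in> rat_span S \<longleftrightarrow> y = f x" for x y
    unfolding f_def using total[of x] unique by (metis the_equality)
  have "f (x + y) = f x + f y" for x y
    using rat_vec.span_add[of "(x, f x)" S "(y, f y)"] f by simp
  then have "Modules.additive f" by (simp add: Modules.additive_def)
  moreover have "f (of_rat q * x) = of_rat q * f x" for q x
    using rat_vec.span_scale[of "(x, f x)" S q] f by simp
  moreover have "(x, f x) \<notin> K" for x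
    using S(1) f unfolding adm_def by blast
  moreover have "f t \<in> prom t" if "t \<in> T" for t
    using S(1) f that unfolding adm_def by blast
  moreover have "\<exists>x\<in>fst ` U \<inter> fst ` V. (x, f x) \<notin> U \<union> V"
    if UV: "open U" "open V" "U \<inter> V = {}" "fst ` U \<inter> fst ` V \<noteq> {}" for U V
    using S(2)[of "(0, U, V)"] UV f unfolding I_def task_def by auto
  ultimately show thesis by (rule that)
qed

end

section \<open>Connectivity\<close>

lemma Cantor_set_affine:
  assumes S: "Cantor_set S" and q: "q \<noteq> 0"
  shows "Cantor_set ((\<lambda>x. q * x + c) ` S)"
proof -
  let ?g = "\<lambda>x. q * x + c"
  have cl: "closed S" using S by (simp add: Cantor_set_def perfect_set_def)
  have eq: "?g ` S = (\<lambda>x. (x - c) / q) -` S"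
    using q by (force simp: image_iff field_simps)
  have cl': "closed (?g ` S)"
    unfolding eq by (intro closed_vimage cl continuous_intros) (use q in simp)
  have lim: "?g x islimpt ?g ` S" if "x \<in> S" for x
  proof -
    obtain X where X: "\<And>n. X n \<in> S - {x}" "X \<longlonglongrightarrow> x"
      using S \<open>x \<in> S\<close> unfolding Cantor_set_def perfect_set_def islimpt_sequential by blast
    have "(\<lambda>n. ?g (X n)) \<longlonglongrightarrow> ?g x" by (intro tendsto_intros X)
    then show ?thesis
      unfolding islimpt_sequential using X(1) q by (intro exI[of _ "\<lambda>n. ?g (X n)"]) auto
  qed
  have "interior (?g ` S) = {}"
  proof (rule ccontr)
    assume "interior (?g ` S) \<noteq> {}"
    then obtain y where y: "y \<in> interior (?g ` S)" by blast
    have "open (?g -` interior (?g ` S))" by (intro open_vimage continuous_intros) auto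
    moreover have "?g -` interior (?g ` S) \<subseteq> S"
      using interior_subset[of "?g ` S"] q by auto
    moreover have "(y - c) / q \<in> ?g -` interior (?g ` S)" using y q by simp
    ultimately have "interior S \<noteq> {}" using interior_maximal by blast
    then show False using S cl by (simp add: Cantor_set_def nowhere_dense_def)
  qed
  then show ?thesis
    using S cl' lim unfolding Cantor_set_def perfect_set_def nowhere_dense_def by auto
qed

text \<open>Restrict a separation of the graph to an open interval between two points on different
  sides. Density of the graph makes the restricted open sets disjoint, connectedness of the interval
  makes their projections overlap, and \<open>hits\<close> then yields a graph point in
  neither.\<close>

lemma connected_graph:
  assumes dense_graph: "\<And>a b c d :: real. a < b \<Longrightarrow> c < d \<Longrightarrow> \<exists>x. a < x \<and> x < b \<and> c < f x \<and> f x < d"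
    and hits: "\<And>U V. open U \<Longrightarrow> open V \<Longrightarrow> U \<inter> V = {} \<Longrightarrow> fst ` U \<inter> fst ` V \<noteq> {} \<Longrightarrow>
      \<exists>x\<in>fst ` U \<inter> fst ` V. (x, f x) \<notin> U \<union> V"
  shows "connectivity_function f"
  unfolding connectivity_function_def
proof (intro allI impI)
  fix Z :: "real set"
  assume Z: "connected Z"
  show "connected (fun_graph f Z)"
  proof (rule connectedI)
    fix A B :: "(real \<times> real) set"
    assume o: "open A" "open B" and ne: "A \<inter> fun_graph f Z \<noteq> {}" "B \<inter> fun_graph f Z \<noteq> {}"
      and disj: "A \<inter> B \<inter> fun_graph f Z = {}" and cov: "fun_graph f Z \<subseteq> A \<union> B"
    obtain x1 x2 where x1: "x1 \<in> Z" "(x1, f x1) \<in> A" and x2: "x2 \<in> Z" "(x2, f x2) \<in> B"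
      using ne unfolding fun_graph_def by blast
    have sep: "\<not> ((x, f x) \<in> A \<and> (x, f x) \<in> B)" if "x \<in> Z" for x
      using disj that unfolding fun_graph_def by blast
    have "x1 \<noteq> x2" using sep x1 x2 by blast
    define a b where "a = min x1 x2" and "b = max x1 x2"
    have ab: "a < b" "a \<in> Z" "b \<in> Z" using \<open>x1 \<noteq> x2\<close> x1 x2 by (auto simp: a_def b_def min_def max_def)
    define I where "I = {a<..<b}"
    have "{a..b} \<subseteq> Z" using Z ab connected_contains_Icc by blast
    then have IZ: "I \<subseteq> Z" unfolding I_def by (rule order.trans[rotated]) auto
    define U V where "U = A \<inter> I \<times> UNIV" and "V = B \<inter> I \<times> UNIV"
    have UV: "open U" "open V" unfolding U_def V_def I_def by (auto intro!: open_Int open_Times o)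
    have box: "\<exists>x. (x, f x) \<in> G" if G: "open G" "p \<in> G" for G :: "(real \<times> real) set" and p
    proof -
      obtain P Q where PQ: "open P" "open Q" "p \<in> P \<times> Q" "P \<times> Q \<subseteq> G"
        using G by (rule open_prod_elim)
      have pPQ: "fst p \<in> P" "snd p \<in> Q" using PQ(3) by (auto simp: mem_Times_iff)
      obtain e1 where e1: "e1 > 0" "ball (fst p) e1 \<subseteq> P"
        using PQ(1) pPQ(1) by (rule openE)
      obtain e2 where e2: "e2 > 0" "ball (snd p) e2 \<subseteq> Q"
        using PQ(2) pPQ(2) by (rule openE)
      obtain x where "fst p - e1 < x" "x < fst p + e1" "snd p - e2 < f x" "f x < snd p + e2"
        using dense_graph[of "fst p - e1" "fst p + e1" "snd p - e2" "snd p + e2"] e1(1) e2(1) by auto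
      then have "x \<in> ball (fst p) e1" "f x \<in> ball (snd p) e2" by (auto simp: dist_real_def)
      then have "x \<in> P" "f x \<in> Q" using e1(2) e2(2) by blast+
      then show ?thesis using PQ(4) by blast
    qed
    have "U \<inter> V = {}"
    proof (rule ccontr)
      assume "U \<inter> V \<noteq> {}"
      then obtain x where "(x, f x) \<in> U \<inter> V" using box[of "U \<inter> V"] UV by blast
      then show False using sep IZ unfolding U_def V_def by blast
    qed
    moreover have "fst ` U \<inter> fst ` V \<noteq> {}"
    proof -
      \<comment> \<open>The two given points lie over the ends of \<open>I\<close>; openness moves
        them inside.\<close>
      have meets: "fst ` (G \<inter> I \<times> UNIV) \<noteq> {}" if G: "open G" "(t, y) \<in> G" "t \<in> {a, b}" for G :: "(real \<times> real) set" and t y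
      proof -
        have "open {s. (s, y) \<in> G}"
          using open_vimage[OF G(1), of "\<lambda>s. (s, y)"] by (simp add: vimage_def continuous_on_Pair)
        moreover have "t \<in> closure I" using G(3) ab(1) unfolding I_def by auto
        ultimately have "{s. (s, y) \<in> G} \<inter> I \<noteq> {}"
          using G(2) open_Int_closure_eq_empty[of "{s. (s, y) \<in> G}" I] by blast
        then show ?thesis by force
      qed
      have "x1 \<in> {a, b}" "x2 \<in> {a, b}" by (auto simp: a_def b_def)
      then have "fst ` U \<noteq> {}" "fst ` V \<noteq> {}"
        using meets[OF o(1) x1(2)] meets[OF o(2) x2(2)] unfolding U_def V_def by auto
      moreover have "I \<subseteq> fst ` U \<union> fst ` V"
      proof
        fix x assume "x \<in> I"
        then have "(x, f x) \<in> U \<union> V" using IZ cov unfolding U_def V_def fun_graph_def by auto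
        then show "x \<in> fst ` U \<union> fst ` V" by force
      qed
      moreover have "fst ` U \<subseteq> I" "fst ` V \<subseteq> I" unfolding U_def V_def by auto
      moreover have "connected I" unfolding I_def by simp
      moreover have "open (fst ` U)" "open (fst ` V)" using UV by (auto intro: open_image_fst)
      ultimately show ?thesis using connectedD[of I "fst ` U" "fst ` V"] by blast
    qed
    ultimately obtain x where x: "x \<in> fst ` U" "(x, f x) \<notin> U \<union> V" using hits UV by blast
    then have "x \<in> I" unfolding U_def by auto
    then show False using x(2) IZ cov unfolding U_def V_def fun_graph_def by auto
  qed
qed

lemma rational_intervals:
  obtains lo hi :: "nat \<Rightarrow> real" where "\<And>n. 0 \<le> lo n" "\<And>n. lo n < hi n" "\<And>n. hi n \<le> 1"
    "\<And>W x. open W \<Longrightarrow> x \<in> W \<Longrightarrow> 0 < x \<Longrightarrow> x < 1 \<Longrightarrow> \<exists>n. {lo n<..<hi n} \<subseteq> W"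
proof -
  define ok where "ok p \<longleftrightarrow> 0 \<le> fst p \<and> fst p < snd p \<and> snd p \<le> 1" for p :: "rat \<times> rat"
  \<comment> \<open>Codes of pairs that do not bound a subinterval of the unit interval default to
    the whole of it.\<close>
  define g :: "nat \<Rightarrow> rat \<times> rat" where "g n = (if ok (from_nat n) then from_nat n else (0, 1))" for n
  define lo hi :: "nat \<Rightarrow> real" where "lo n = of_rat (fst (g n))" and "hi n = of_rat (snd (g n))" for n
  have ok: "ok (g n)" for n by (simp add: g_def ok_def)
  have "\<exists>n. {lo n<..<hi n} \<subseteq> W" if W: "open W" "x \<in> W" "0 < x" "x < 1" for W x
  proof -
    obtain e where e: "e > 0" "ball x e \<subseteq> W" using W(1,2) open_contains_ball by blast
    obtain p :: rat where p: "max 0 (x - e) < of_rat p" "of_rat p < x"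
      using of_rat_dense[of "max 0 (x - e)" x] e(1) W(3) by auto
    obtain q :: rat where q: "x < of_rat q" "of_rat q < min 1 (x + e)"
      using of_rat_dense[of x "min 1 (x + e)"] e(1) W(4) by auto
    have "(of_rat p :: real) < of_rat q" "(0 :: real) < of_rat p" "(of_rat q :: real) < 1"
      using p q by linarith+
    then have "ok (p, q)" unfolding ok_def by (simp add: of_rat_less)
    then have g: "g (to_nat (p, q)) = (p, q)" by (simp add: g_def)
    have "{lo (to_nat (p, q))<..<hi (to_nat (p, q))} \<subseteq> ball x e"
      using p q unfolding lo_def hi_def g by (auto simp: dist_real_def)
    then show ?thesis using e(2) by blast
  qed
  moreover have "0 \<le> lo n" "lo n < hi n" "hi n \<le> 1" for n
    using ok[of n] unfolding lo_def hi_def ok_def by (simp_all add: of_rat_less)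
  ultimately show ?thesis by (rule that[rotated 3])
qed

section \<open>The main construction\<close>

text \<open>The sequences that start with \<open>True\<close> index the members of the Cantor sets on which \<open>f\<close> is to
  be controlled: their odd entries encode the target set. The sequences \<open>spare n\<close> give the jump
  points of the barrier, and the constant sequence \<open>False\<close> is left out so that the span of the
  others is not the whole line.\<close>

definition spare :: "nat \<Rightarrow> nat \<Rightarrow> bool" where
  "spare n = (\<lambda>i. i = 1 \<or> i = n + 2)"

lemma inj_spare: "inj spare"
proof (rule injI)
  fix n k assume "spare n = spare k"
  then have "spare n (n + 2) = spare k (n + 2)" by simp
  then show "n = k" by (simp add: spare_def)
qed

text \<open>A compact set containing all unscaled generators. The jump points will be dense in the
  unit interval, far from compact, but rational scaling keeps them in the span of this set.\<close>

definition core :: "real set" where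
  "core = seqnum ` cylinder {0} (\<lambda>_. True) \<union> seqnum ` cylinder {1} (\<lambda>_. True)"

lemma proper_span_core: "rat_span core \<noteq> UNIV"
proof
  assume UNIV: "rat_span core = UNIV"
  have "\<not> rat_dependent (range seqnum)"
    using seqnum_scaled_independent(1)[of "\<lambda>_. 1"] by simp
  moreover have "core \<subseteq> range seqnum - {seqnum (\<lambda>_. False)}"
    using inj_seqnum unfolding core_def cylinder_def by (force dest: injD)
  then have "seqnum (\<lambda>_. False) \<in> rat_span (range seqnum - {seqnum (\<lambda>_. False)})"
    using rat_vec.span_mono UNIV by blast
  ultimately show False unfolding rat_vec.dependent_def by blast
qed

lemma meager_span_core: "meager (rat_span core)"
  by (rule meager_span_compact[OF _ proper_span_core])
     (auto simp: core_def compact_seqnum_cylinder intro: compact_Un)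

lemma closed_set_code:
  obtains code :: "real set \<Rightarrow> nat set" where "inj_on code {P. closed P}"
proof -
  have "{U :: real set. open U} \<lesssim> (UNIV :: nat set set)"
    using open_sets_lepoll_real nat_sets_eqpoll_reals eqpoll_sym lepoll_trans2 by blast
  then obtain g :: "real set \<Rightarrow> nat set" where g: "inj_on g {U. open U}"
    unfolding lepoll_def by blast
  have "inj_on (\<lambda>P. g (- P)) {P. closed P}"
    by (rule inj_onI) (use g in \<open>auto dest: inj_onD\<close>)
  then show ?thesis using that by blast
qed

text \<open>Distinct closed targets receive disjoint Cantor sets, so no number gets two
  promises.\<close>

lemma Cantor_family:
  obtains C :: "real set \<Rightarrow> real set" where
    "\<And>P. Cantor_set (C P)" "\<And>P. C P \<subseteq> seqnum ` cylinder {0} (\<lambda>_. True)"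
    "\<And>P Q t. closed P \<Longrightarrow> closed Q \<Longrightarrow> t \<in> C P \<Longrightarrow> t \<in> C Q \<Longrightarrow> P = Q"
proof -
  obtain code :: "real set \<Rightarrow> nat set" where code: "inj_on code {P. closed P}"
    by (rule closed_set_code)
  \<comment> \<open>Entry \<open>0\<close> marks the family, entry \<open>2 * n + 1\<close> tells
    whether \<open>n\<close> belongs to the code, and the positive even entries stay free.\<close>
  define A where "A = insert 0 {i::nat. odd i}"
  define c where "c P i \<longleftrightarrow> i = 0 \<or> i div 2 \<in> code P" for P and i :: nat
  define C where "C P = seqnum ` cylinder A (c P)" for P
  have sub: "C P \<subseteq> seqnum ` cylinder {0} (\<lambda>_. True)" for P
    unfolding C_def by (intro image_mono) (auto simp: cylinder_def A_def c_def)
  have inf: "infinite (- A)"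
    unfolding infinite_nat_iff_unbounded_le
  proof
    fix k :: nat
    show "\<exists>n\<ge>k. n \<in> - A" by (intro exI[of _ "2 * k + 2"]) (simp add: A_def)
  qed
  have closed: "closed (C P)" for P
    unfolding C_def by (intro compact_imp_closed compact_seqnum_cylinder)
  have "C P \<subseteq> rat_span core" for P
    using sub[of P] rat_vec.span_superset[of core] unfolding core_def by blast
  then have "interior (C P) = {}" for P
    using proper_span_interior[OF proper_span_core] by blast
  moreover have "c P \<in> cylinder A (c P)" for P by (simp add: cylinder_def)
  then have "C P \<noteq> {}" for P unfolding C_def by blast
  ultimately have "Cantor_set (C P)" for P
    unfolding Cantor_set_def perfect_set_def nowhere_dense_def
    using closed seqnum_cylinder_islimpt[OF inf] by (auto simp: C_def)
  moreover have "P = Q" if PQ: "closed P" "closed Q" and t: "t \<in> C P" "t \<in> C Q" for P Q t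
  proof -
    obtain b where b: "t = seqnum b" "b \<in> cylinder A (c P)" "b \<in> cylinder A (c Q)"
      using t inj_seqnum unfolding C_def by (auto dest: injD)
    have "n \<in> code P \<longleftrightarrow> n \<in> code Q" for n
    proof -
      have "2 * n + 1 \<in> A" by (simp add: A_def)
      then have "c P (2 * n + 1) \<longleftrightarrow> c Q (2 * n + 1)"
        using b(2,3) unfolding cylinder_def by blast
      then show ?thesis by (simp add: c_def)
    qed
    then have "code P = code Q" by blast
    then show ?thesis using code PQ by (auto dest: inj_onD)
  qed
  ultimately show ?thesis using that sub by blast
qed

text \<open>Rational multiples of a positive number are dense, so the \<open>n\<close>-th spare
  number fits into the \<open>n\<close>-th interval. The factor 1 for sequences starting with
  \<open>True\<close> leaves the Cantor sets in place.\<close>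

lemma scaled_spares:
  fixes lo hi :: "nat \<Rightarrow> real"
  assumes "\<And>n. 0 \<le> lo n" "\<And>n. lo n < hi n"
  obtains r :: "(nat \<Rightarrow> bool) \<Rightarrow> rat" where "\<And>b. r b \<noteq> 0" "\<And>b. b 0 \<Longrightarrow> r b = 1"
    "\<And>n. lo n < of_rat (r (spare n)) * seqnum (spare n)" "\<And>n. of_rat (r (spare n)) * seqnum (spare n) < hi n"
proof -
  have pos: "0 < seqnum b" for b
    using seqnum_bounds(1)[of b] seqnum_relation[of "{b}" "\<lambda>_. 1" b] by (auto simp: less_le)
  have "\<exists>q::rat. q \<noteq> 0 \<and> lo n < of_rat q * seqnum (spare n) \<and> of_rat q * seqnum (spare n) < hi n" for n
  proof -
    have "lo n / seqnum (spare n) < hi n / seqnum (spare n)"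
      using assms(2) pos by (simp add: divide_strict_right_mono)
    then obtain q :: rat where q: "lo n / seqnum (spare n) < of_rat q" "of_rat q < hi n / seqnum (spare n)"
      using of_rat_dense by blast
    have "0 \<le> lo n / seqnum (spare n)" using assms(1)[of n] pos[of "spare n"] by simp
    then have "(0::real) < of_rat q" using q(1) by linarith
    then have "q \<noteq> 0" by auto
    moreover have "lo n < of_rat q * seqnum (spare n)" "of_rat q * seqnum (spare n) < hi n"
      using q pos[of "spare n"] by (simp_all add: pos_divide_less_eq pos_less_divide_eq)
    ultimately show ?thesis by blast
  qed
  then obtain s :: "nat \<Rightarrow> rat" where s: "\<And>n. s n \<noteq> 0"
    "\<And>n. lo n < of_rat (s n) * seqnum (spare n)" "\<And>n. of_rat (s n) * seqnum (spare n) < hi n"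
    by metis
  define r where "r b = (if b \<in> range spare then s (inv spare b) else 1)" for b
  have "r (spare n) = s n" for n
    using inj_spare by (simp add: r_def)
  moreover have "r b = 1" if "b 0" for b
    using that by (auto simp: r_def spare_def)
  moreover have "r b \<noteq> 0" for b using s(1) by (simp add: r_def)
  ultimately show ?thesis using s(2,3) by (intro that[of r]) simp_all
qed

theorem theorem2p3:
  assumes "\<And>\<F> :: real set set.
    \<F> \<prec> (UNIV :: real set) \<Longrightarrow> (\<And>A. A \<in> \<F> \<Longrightarrow> meager A) \<Longrightarrow> meager (\<Union>\<F>)"
  shows "\<exists>f :: real \<Rightarrow> real.
    Modules.additive f \<and> Cantor_ivp f \<and> connectivity_function f \<and> \<not> almost_continuous f"
proof -
  obtain lo hi :: "nat \<Rightarrow> real" where lohi: "\<And>n. 0 \<le> lo n" "\<And>n. lo n < hi n" "\<And>n. hi n \<le> 1"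
    and base: "\<And>W x. open W \<Longrightarrow> x \<in> W \<Longrightarrow> 0 < x \<Longrightarrow> x < 1 \<Longrightarrow> \<exists>n. {lo n<..<hi n} \<subseteq> W"
    by (rule rational_intervals, rule that)
  obtain r :: "(nat \<Rightarrow> bool) \<Rightarrow> rat" where r: "\<And>b. r b \<noteq> 0" "\<And>b. b 0 \<Longrightarrow> r b = 1"
    "\<And>n. lo n < of_rat (r (spare n)) * seqnum (spare n)" "\<And>n. of_rat (r (spare n)) * seqnum (spare n) < hi n"
    by (rule scaled_spares[OF lohi(1,2)], rule that)
  define v where "v b = of_rat (r b) * seqnum b" for b
  have inj_v: "inj v" and indep_v: "\<not> rat_dependent (range v)"
    using seqnum_scaled_independent[of r] r(1) unfolding v_def[abs_def] by auto
  define d where "d n = v (spare n)" for n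
  have d: "lo n < d n" "d n < hi n" "0 < d n" "d n < 1" for n
    using r(3,4)[of n] lohi(1)[of n] lohi(3)[of n] unfolding d_def v_def by linarith+
  obtain m where "bounded_mono m 2" and jump: "\<And>n. left_lim m (d n) < right_lim m (d n)"
    by (rule jump_function[of d], rule that)
  interpret bounded_mono m 2 by fact
  obtain C :: "real set \<Rightarrow> real set" where C: "\<And>P. Cantor_set (C P)"
    and C_sub: "\<And>P. C P \<subseteq> seqnum ` cylinder {0} (\<lambda>_. True)"
    and C_inj: "\<And>P Q t. closed P \<Longrightarrow> closed Q \<Longrightarrow> t \<in> C P \<Longrightarrow> t \<in> C Q \<Longrightarrow> P = Q"
    by (rule Cantor_family, rule that)
  define T where "T = seqnum ` cylinder {0} (\<lambda>_. True) \<union> range d"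
  have v_eq: "v b = seqnum b" if "b 0" for b using r(2)[of b] that by (simp add: v_def)
  have T_v: "T \<subseteq> range v"
    unfolding T_def cylinder_def d_def using v_eq by (auto intro: rangeI simp flip: v_eq)
  \<comment> \<open>This keeps the promises at jump points from colliding with those on the Cantor
    sets: \<open>spare n\<close> starts with \<open>False\<close>.\<close>
  have d_notin: "d n \<notin> C P" for n P
  proof
    assume "d n \<in> C P"
    then obtain b where b: "b 0" "d n = seqnum b" using C_sub[of P] by (auto simp: cylinder_def)
    then have "v (spare n) = v b" by (simp add: d_def v_eq)
    then have "spare n = b" using inj_v by (rule injD[rotated])
    then show False using b(1) by (auto simp: spare_def)
  qed
  have "T \<subseteq> rat_span core"
  proof -
    have "seqnum (spare n) \<in> core" for n
      by (auto simp: core_def cylinder_def spare_def)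
    then have "rat_scale (r (spare n)) (seqnum (spare n)) \<in> rat_span core" for n
      by (intro rat_vec.span_scale rat_vec.span_base)
    then have "range d \<subseteq> rat_span core" by (auto simp: d_def v_def)
    moreover have "seqnum ` cylinder {0} (\<lambda>_. True) \<subseteq> rat_span core"
      using rat_vec.span_superset[of core] unfolding core_def by blast
    ultimately show ?thesis unfolding T_def by blast
  qed
  then have "rat_span T \<subseteq> rat_span core" by (rule rat_vec.span_minimal) simp
  then have T_meager: "meager (rat_span T)" using meager_span_core meager_subset by blast
  \<comment> \<open>Off the jump points, \<open>C_inj\<close> leaves at most one \<open>P\<close>,
    so the promise is that \<open>P\<close>, or the whole line if there is none.\<close>
  define prom where "prom t = (if t \<in> range d then {drift t + L t<..<drift t + R t}
     else {y. \<forall>P. Cantor_set P \<longrightarrow> t \<in> C P \<longrightarrow> y \<in> P})" for t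
  have closedP: "closed P" if "Cantor_set P" for P
    using that by (simp add: Cantor_set_def perfect_set_def)
  have prom_large: "(UNIV :: real set) \<lesssim> prom t" for t
  proof (cases "t \<in> range d")
    case True
    then show ?thesis using jump by (auto simp: prom_def intro!: open_interval_lepoll)
  next
    case t: False
    show ?thesis
    proof (cases "\<exists>P. Cantor_set P \<and> t \<in> C P")
      case True
      then obtain P where P: "Cantor_set P" "t \<in> C P" by blast
      have uniq: "Q = P" if "Cantor_set Q" "t \<in> C Q" for Q
        using C_inj[OF closedP[OF that(1)] closedP[OF P(1)] that(2) P(2)] .
      have "prom t = {y. \<forall>P. Cantor_set P \<longrightarrow> t \<in> C P \<longrightarrow> y \<in> P}" using t by (simp add: prom_def)
      also have "\<dots> = P" using P uniq by blast
      finally have "prom t = P" .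
      then show ?thesis using P(1) perfect_set_lepoll by (simp add: Cantor_set_def)
    next
      case False
      then have "prom t = UNIV" using t by (auto simp: prom_def)
      then show ?thesis by simp
    qed
  qed
  interpret promise "barrier m" "range d" T prom
  proof
    show "meager (\<Union>\<F>)" if "\<F> \<prec> (UNIV :: real set)" "\<And>A. A \<in> \<F> \<Longrightarrow> meager A" for \<F> :: "real set set"
      using assms that by blast
    show "(0, 0) \<notin> barrier m" by (simp add: barrier_def)
    show "countable {y. (x, y) \<in> barrier m}" for x
      by (rule countable_subset[of _ "{drift x + L x, drift x + R x}"]) (auto simp: barrier_def)
    show "\<exists>\<epsilon>>0. (\<forall>x k. t - \<epsilon> < x \<longrightarrow> x < t \<longrightarrow> (x, k) \<in> barrier m \<longrightarrow> k < y) \<and>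
        (\<forall>x k. t < x \<longrightarrow> x < t + \<epsilon> \<longrightarrow> (x, k) \<in> barrier m \<longrightarrow> y < k)"
      if "t \<in> range d" "y \<in> prom t" for t y
      using that d by (intro barrier_gap) (auto simp: prom_def)
    show "W \<inter> range d \<noteq> {}" if W: "open W" "W \<inter> fst ` barrier m \<noteq> {}" for W
    proof -
      obtain x where "x \<in> W" "0 < x" "x < 1" using W(2) by (auto simp: barrier_def)
      then obtain n where "{lo n<..<hi n} \<subseteq> W" using base[OF W(1)] by blast
      then have "d n \<in> W" using d(1,2)[of n] by auto
      then show ?thesis by blast
    qed
    show "range d \<subseteq> T" by (simp add: T_def)
    show "\<not> rat_dependent T" using T_v indep_v rat_vec.dependent_mono by blast
    show "(UNIV :: real set) \<lesssim> prom t" for t by (rule prom_large)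
  qed (rule T_meager)
  obtain f where add: "Modules.additive f" and scale: "\<And>q x. f (of_rat q * x) = of_rat q * f x"
    and avoid: "\<And>x. (x, f x) \<notin> barrier m" and keep: "\<And>t. t \<in> T \<Longrightarrow> f t \<in> prom t"
    and hits: "\<And>U V. open U \<Longrightarrow> open V \<Longrightarrow> U \<inter> V = {} \<Longrightarrow> fst ` U \<inter> fst ` V \<noteq> {} \<Longrightarrow>
      \<exists>x\<in>fst ` U \<inter> fst ` V. (x, f x) \<notin> U \<union> V"
    by (rule exists_function, rule that)
  have f_C: "f t \<in> P" if "Cantor_set P" "t \<in> C P" for P t
  proof -
    have "t \<in> T" using that(2) C_sub unfolding T_def by blast
    moreover have "t \<notin> range d" using d_notin that(2) by blast
    ultimately show ?thesis using keep[of t] that unfolding prom_def by auto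
  qed
  \<comment> \<open>Since f(q t + c) = q f(t) + f(c) for rational \<open>q\<close> and
    \<open>c\<close>, pulling the target back to \<open>P'\<close> and shrinking \<open>C P'\<close>
    into the interval reduces the claim to the promise on \<open>C P'\<close>.\<close>
  have Cantor_preimage: "\<exists>A. Cantor_set A \<and> A \<subseteq> {a<..<b} \<and> f ` A \<subseteq> P"
    if "a < b" and P: "Cantor_set P" for a b :: real and P
  proof -
    obtain c :: rat where c: "a < of_rat c" "of_rat c < b" using of_rat_dense[OF \<open>a < b\<close>] by blast
    \<comment> \<open>The 2 is the upper bound for \<open>seqnum\<close>.\<close>
    obtain q :: rat where q: "0 < (of_rat q :: real)" "of_rat q < (b - of_rat c) / 2"
      using of_rat_dense[of 0 "(b - of_rat c) / 2"] c(2) by auto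
    define P' where "P' = (\<lambda>y. 1 / of_rat q * y + - f (of_rat c) / of_rat q) ` P"
    have "Cantor_set P'" unfolding P'_def by (rule Cantor_set_affine[OF P]) (use q in auto)
    define A where "A = (\<lambda>t. of_rat q * t + of_rat c) ` C P'"
    have "Cantor_set A" unfolding A_def by (rule Cantor_set_affine[OF C]) (use q in auto)
    moreover have "A \<subseteq> {a<..<b}"
    proof
      fix x assume "x \<in> A"
      then obtain t where t: "t \<in> C P'" "x = of_rat q * t + of_rat c" unfolding A_def by blast
      have "0 \<le> t" "t \<le> 2" using t(1) C_sub[of P'] seqnum_bounds by auto
      then have "0 \<le> of_rat q * t" "of_rat q * t \<le> of_rat q * 2"
        using q(1) by (auto intro: mult_left_mono)
      then show "x \<in> {a<..<b}" using t(2) c q(2) by auto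
    qed
    moreover have "f ` A \<subseteq> P"
    proof
      fix y assume "y \<in> f ` A"
      then obtain t where t: "t \<in> C P'" "y = f (of_rat q * t + of_rat c)" unfolding A_def by blast
      have "f t \<in> P'" using f_C \<open>Cantor_set P'\<close> t(1) by blast
      then obtain z where z: "z \<in> P" "f t = 1 / of_rat q * z + - f (of_rat c) / of_rat q"
        unfolding P'_def by blast
      have "y = of_rat q * f t + f (of_rat c)"
        using t(2) add scale by (simp add: Modules.additive_def)
      also have "\<dots> = z" using q(1) unfolding z(2) by (simp add: field_simps)
      finally show "y \<in> P" using z(1) by simp
    qed
    ultimately show ?thesis by blast
  qed
  have "Cantor_ivp f"
    unfolding Cantor_ivp_def
  proof (intro allI impI)
    fix x y P assume P: "Cantor_set P \<and> P \<subseteq> open_segment (f x) (f y)"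
    then have "f x \<noteq> f y" by (auto simp: Cantor_set_def)
    then have "x \<noteq> y" by blast
    then have "open_segment x y = {min x y<..<max x y}" "min x y < max x y"
      by (auto simp: open_segment_eq_real_ivl min_def max_def)
    then show "\<exists>A. Cantor_set A \<and> A \<subseteq> open_segment x y \<and> f ` A \<subseteq> P"
      using Cantor_preimage P by metis
  qed
  moreover have "connectivity_function f"
  proof (rule connected_graph[OF _ hits])
    fix a b u w :: real
    assume "a < b" "u < w"
    \<comment> \<open>The affine map sends the interval from 0 to 2, which contains
      \<open>C {}\<close>, onto the middle half of the interval from \<open>u\<close> to
      \<open>w\<close>.\<close>
    define P where "P = (\<lambda>t. (w - u) / 4 * t + (3 * u + w) / 4) ` C {}"
    have "Cantor_set P" unfolding P_def by (rule Cantor_set_affine[OF C]) (use \<open>u < w\<close> in auto)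
    then obtain A where A: "Cantor_set A" "A \<subseteq> {a<..<b}" "f ` A \<subseteq> P"
      using Cantor_preimage[OF \<open>a < b\<close>] by blast
    obtain x where "x \<in> A" using A(1) by (auto simp: Cantor_set_def)
    then obtain t where t: "t \<in> C {}" "f x = (w - u) / 4 * t + (3 * u + w) / 4"
      using A(3) unfolding P_def by blast
    have "0 \<le> t" "t \<le> 2" using t(1) C_sub[of "{}"] seqnum_bounds by auto
    then have "0 \<le> (w - u) / 4 * t" "(w - u) / 4 * t \<le> (w - u) / 4 * 2"
      using \<open>u < w\<close> by (intro mult_nonneg_nonneg mult_left_mono; simp)+
    then have "u < f x" "f x < w" using \<open>u < w\<close> unfolding t(2) by (auto simp: field_simps)
    moreover have "a < x" "x < b" using \<open>x \<in> A\<close> A(2) by auto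
    ultimately show "\<exists>x. a < x \<and> x < b \<and> u < f x \<and> f x < w" by blast
  qed
  moreover have "\<not> almost_continuous f"
  proof
    assume "almost_continuous f"
    moreover have "open (- barrier m)" using closed_barrier by (rule open_Compl)
    moreover have "fun_graph f UNIV \<subseteq> - barrier m" using avoid by (auto simp: fun_graph_def)
    ultimately obtain g where "continuous_on UNIV g" "fun_graph g UNIV \<subseteq> - barrier m"
      unfolding almost_continuous_def by blast
    then show False using barrier_meets_continuous unfolding fun_graph_def by blast
  qed
  ultimately show ?thesis using add by blast
qed

end
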